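(* There is a set of rigidity $S\subseteq\mathbb Z$ such that $S$ is dense in the Bohr topology of $\mathbb Z$.
   Context: A set $S\subseteq\mathbb Z$ is a set of rigidity if $S$ is infinite and there is a nontrivial ergodic measure preserving system $(X,\mu,T)$ (probability space, invertible measure preserving $T$) such that for all measurable $D\subseteq X$ and all $\varepsilon>0$ the set $\{n\in S:\mu(D\triangle T^nD)>\varepsilon\}$ is finite. The Bohr topology on $\mathbb Z$ is the weakest topology making every homomorphism $\chi:\mathbb Z\to\mathbb T=\mathbb R/\mathbb Z$ continuous. *)

theory Defs
  imports "HOL-Probability.Probability"
begin

text \<open>We model the circle group T = R/Z by the (isomorphic as a topological group)
  unit circle in the complex plane, with multiplication as group law.
  A homomorphism chi : Z -> T is a map into the unit circle turning addition into
  multiplication.\<close>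

definition circle_hom :: "(int \<Rightarrow> complex) \<Rightarrow> bool" where
  "circle_hom c \<longleftrightarrow> (\<forall>n. c n \<in> sphere 0 1) \<and> (\<forall>m n. c (m + n) = c m * c n)"

definition bohr_topology :: "int topology" where
  "bohr_topology = topology_generated_by
     {c -` U | c U. circle_hom c \<and> open (U :: complex set)}"

definition bohr_dense :: "int set \<Rightarrow> bool" where
  "bohr_dense S \<longleftrightarrow> bohr_topology closure_of S = UNIV"

definition inv_mps :: "'a measure \<Rightarrow> ('a \<Rightarrow> 'a) \<Rightarrow> bool" where
  "inv_mps M T \<longleftrightarrow> prob_space M \<and> bij_betw T (space M) (space M) \<and>
     T \<in> measurable M M \<and> distr M M T = M \<and>
     inv_into (space M) T \<in> measurable M M \<and> distr M M (inv_into (space M) T) = M"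

definition tpow :: "'a measure \<Rightarrow> ('a \<Rightarrow> 'a) \<Rightarrow> int \<Rightarrow> 'a \<Rightarrow> 'a" where
  "tpow M T n = (if 0 \<le> n then T ^^ nat n else inv_into (space M) T ^^ nat (- n))"

definition ergodic_sys :: "'a measure \<Rightarrow> ('a \<Rightarrow> 'a) \<Rightarrow> bool" where
  "ergodic_sys M T \<longleftrightarrow> (\<forall>A \<in> sets M. T -` A \<inter> space M = A \<longrightarrow>
      measure M A = 0 \<or> measure M A = 1)"

definition nontrivial_sys :: "'a measure \<Rightarrow> bool" where
  "nontrivial_sys M \<longleftrightarrow> (\<exists>A \<in> sets M. 0 < measure M A \<and> measure M A < 1)"

definition rigid_along :: "'a measure \<Rightarrow> ('a \<Rightarrow> 'a) \<Rightarrow> int set \<Rightarrow> bool" where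
  "rigid_along M T S \<longleftrightarrow> (\<forall>D \<in> sets M. \<forall>\<epsilon>>0.
      finite {n \<in> S. measure M ((D - tpow M T n ` D) \<union> (tpow M T n ` D - D)) > \<epsilon>})"

definition set_of_rigidity :: "int set \<Rightarrow> bool" where
  "set_of_rigidity S \<longleftrightarrow> infinite S \<and>
     (\<exists>(M :: real measure) T. inv_mps M T \<and> ergodic_sys M T \<and> nontrivial_sys M
        \<and> rigid_along M T S)"

end

theory Submission
  imports Defs "HOL-Analysis.Kronecker_Approximation_Theorem"
begin

text \<open>
  The system is a limit of cyclic permutations of \<open>\<int>/L\<^sub>m\<close>. Given level \<open>m\<close>, pick many angles
  \<open>\<theta>\<^sub>1, \<dots>, \<theta>\<^sub>M\<close> near \<open>1/L\<^sub>m\<close> that together with 1 are rationally independent. Given \<open>k \<ll> M\<close> frequencies \<open>\<alpha>\<^sub>i\<close>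
  and a target \<open>n\<^sub>0\<close>, linear algebra and Kronecker's theorem yield \<open>n\<close> with \<open>n \<alpha>\<^sub>i \<approx> n\<^sub>0 \<alpha>\<^sub>i\<close> for all \<open>i\<close> and
  \<open>n \<theta>\<^sub>j \<approx> 0\<close> for all but \<open>k\<close> of the \<open>j\<close>; by compactness finitely many such \<open>n\<close> serve all \<open>\<alpha>\<close>. These form the
  finite set \<open>S\<^sub>m\<close>. Then replace the \<open>\<theta>\<^sub>j\<close> by fractions \<open>a\<^sub>j/q\<close>, and map \<open>\<int>/L\<^sub>m\<^sub>+\<^sub>1\<close>, with \<open>L\<^sub>m\<^sub>+\<^sub>1 = M q\<close>, to \<open>\<int>/L\<^sub>m\<close>
  by reading off, in the \<open>j\<close>-th block of length \<open>q\<close>, the orbit of the rotation by \<open>a\<^sub>j/q\<close>. As \<open>a\<^sub>j/q \<approx> 1/L\<^sub>m\<close>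
  this map almost commutes with the cyclic permutations, and each \<open>n \<in> S\<^sub>m\<close> moves only few positions to a
  different symbol. In the limit process a time window of length \<open>L\<^sub>m\<close> almost always sees a full period of
  level \<open>m\<close>, which gives ergodicity, while \<open>\<Union>\<^sub>m S\<^sub>m\<close> is Bohr dense and consists of rigidity times.
\<close>

section \<open>Simultaneous approximation\<close>

text \<open>Makes rational independence of reals a case of linear independence, so that spans and
  exchange arguments apply.\<close>

interpretation rat_real: vector_space "\<lambda>(r::rat) (x::real). of_rat r * x"
  by unfold_locales (simp_all add: algebra_simps of_rat_add of_rat_mult)

text \<open>Kronecker's inhomogeneous theorem for a set of angles. An integer relation is in
  particular a rational one, so rational independence yields the independence over the integers that
  \<open>Kronecker_thm_2\<close> asks for.\<close>

lemma kronecker_independent: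
  fixes B :: "real set" and \<beta> :: "real \<Rightarrow> real"
  assumes "finite B" "1 \<notin> B" and ind: "rat_real.independent (insert 1 B)" and "\<epsilon> > 0"
  shows "\<exists>t::int. \<forall>b\<in>B. \<exists>m::int. \<bar>of_int t * b - of_int m - \<beta> b\<bar> < \<epsilon>"
proof -
  define N where "N = card B"
  obtain f where f: "bij_betw f {..<N} B"
    using ex_bij_betw_nat_finite[OF \<open>finite B\<close>] by (auto simp: N_def lessThan_atLeast0)
  \<comment> \<open>\<open>Kronecker_thm_2\<close> expects the controlled angles at the indices
    below \<open>N\<close> and the number 1 at index \<open>N\<close>.\<close>
  define \<theta> where "\<theta> = (\<lambda>i. if i < N then f i else 1)"
  have img: "\<theta> ` {..N} = insert 1 B"
  proof -
    have "{..N} = insert N {..<N}" by auto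
    then show ?thesis using f by (auto simp: \<theta>_def bij_betw_def)
  qed
  have inj: "inj_on \<theta> {..N}"
  proof (rule eq_card_imp_inj_on)
    show "card (\<theta> ` {..N}) = card {..N}"
      unfolding img using assms by (simp add: N_def)
  qed simp
  interpret Z: Modules.module "(\<lambda>r. (*) (real_of_int r))"
    by (simp add: Modules.module.intro distrib_left mult.commute)
  have indZ: "Z.independent (insert 1 B)"
  proof
    assume "Z.dependent (insert 1 B)"
    then obtain t u where t: "finite t" "t \<subseteq> insert 1 B" "(\<Sum>v\<in>t. real_of_int (u v) * v) = 0" "\<exists>v\<in>t. u v \<noteq> 0"
      unfolding Z.dependent_explicit by blast
    have "rat_real.dependent (insert 1 B)"
      unfolding rat_real.dependent_explicit
      by (rule exI[of _ t], rule exI[of _ "\<lambda>v. of_int (u v)"]) (use t in auto)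
    then show False using ind by blast
  qed
  have "\<exists>k m. \<forall>i<N. \<bar>of_int k * \<theta> i - of_int (m i) - \<beta> (\<theta> i)\<bar> < \<epsilon>"
  proof (rule Kronecker_thm_2[of \<theta> N \<epsilon> "\<lambda>i. \<beta> (\<theta> i)"])
    show "Z.independent (\<theta> ` {..N})" by (simp add: img indZ)
    show "\<theta> N = 1" by (simp add: \<theta>_def)
  qed (use inj \<open>\<epsilon> > 0\<close> in blast)+
  then obtain k :: int and m :: "nat \<Rightarrow> int"
    where km: "\<And>i. i < N \<Longrightarrow> \<bar>of_int k * \<theta> i - of_int (m i) - \<beta> (\<theta> i)\<bar> < \<epsilon>"
    by blast
  have "\<exists>m::int. \<bar>of_int k * b - of_int m - \<beta> b\<bar> < \<epsilon>" if "b \<in> B" for b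
  proof -
    have "b \<in> f ` {..<N}" using f that by (simp add: bij_betw_def)
    then obtain i where "i < N" "b = f i" by blast
    then show ?thesis using km[of i] by (auto simp: \<theta>_def)
  qed
  then show ?thesis by blast
qed

text \<open>Steinitz exchange: extend 1 by elements of \<open>A\<close> to a basis \<open>B0\<close>
  of the span of \<open>A\<close> and 1, then by elements of \<open>X\<close> to a basis
  \<open>C\<close>. Since \<open>C\<close> spans the independent set \<open>insert 1 X\<close>, it
  has more than \<open>card X\<close> elements, and at most \<open>card A + 1\<close> of them lie in
  \<open>B0\<close>; so all but at most \<open>card A\<close> elements of \<open>X\<close> survive
  in \<open>X'\<close>.\<close>

lemma rat_independent_exchange:
  fixes X A :: "real set"
  assumes "finite X" "finite A" "1 \<notin> X" and ind: "rat_real.independent (insert 1 X)"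
  obtains B X' where "B \<subseteq> A" "X' \<subseteq> X" "1 \<notin> B \<union> X'" "B \<inter> X' = {}"
    "rat_real.independent (insert 1 (B \<union> X'))" "A \<subseteq> rat_real.span (insert 1 B)"
    "card (X - X') \<le> card A"
proof -
  have i1: "rat_real.independent {1}" by simp
  obtain B0 where B0: "{1} \<subseteq> B0" "B0 \<subseteq> insert 1 A" "rat_real.independent B0" "insert 1 A \<subseteq> rat_real.span B0"
    using rat_real.maximal_independent_subset_extend[OF _ i1, of "insert 1 A"] by blast
  obtain C where C: "B0 \<subseteq> C" "C \<subseteq> B0 \<union> X" "rat_real.independent C" "B0 \<union> X \<subseteq> rat_real.span C"
    using rat_real.maximal_independent_subset_extend[OF _ B0(3), of "B0 \<union> X"] by blast
  have fB0: "finite B0" using B0(2) assms(2) finite_subset by blast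
  have fC: "finite C" using C(2) fB0 assms(1) finite_subset by blast
  define B where "B = B0 - {1}"
  define X' where "X' = C - B0"
  have sub: "B \<subseteq> A" "X' \<subseteq> X" using B0 C by (auto simp: B_def X'_def)
  have insB: "insert 1 B = B0" using B0(1) by (auto simp: B_def)
  have insC: "insert 1 (B \<union> X') = C" using B0(1) C(1) by (auto simp: B_def X'_def)
  have "insert 1 X \<subseteq> rat_real.span C" using B0(1) C by auto
  then have "card (insert 1 X) \<le> card C"
    using rat_real.independent_span_bound[OF fC ind] by simp
  moreover have "card C = card B0 + card X'"
    using C(1) fC fB0 by (simp add: X'_def card_Diff_subset card_mono)
  moreover have "card B0 \<le> Suc (card A)"
    using card_mono[OF _ B0(2)] assms(2) card_insert_le_m1 by (metis card_insert_le card_insert_if finite_insert le_SucI le_trans order_refl)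
  moreover have "card (X - X') = card X - card X'"
    using sub(2) assms(1) by (simp add: card_Diff_subset finite_subset)
  ultimately have "card (X - X') \<le> card A" using assms by simp
  then show thesis
    using that[of B X'] sub assms(3) C(3) B0(4) insB insC by (auto simp: B_def X'_def)
qed

text \<open>Only integer coefficients are compatible with errors modulo 1, hence the clearing of
  denominators. Elements are added one by one, multiplying the old denominator by one for the new
  coordinates.\<close>

lemma rat_span_common_denominator:
  fixes B :: "real set"
  assumes "finite A" "finite B" "A \<subseteq> rat_real.span B"
  shows "\<exists>D::int. D > 0 \<and> (\<forall>a\<in>A. \<exists>c::real \<Rightarrow> int. of_int D * a = (\<Sum>b\<in>B. of_int (c b) * b))"
  using assms(1,3)
proof (induction A rule: finite_induct)
  case empty
  show ?case by (rule exI[of _ 1]) simp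
next
  case (insert a A)
  then obtain D where D: "D > 0" "\<forall>a\<in>A. \<exists>c::real \<Rightarrow> int. of_int D * a = (\<Sum>b\<in>B. of_int (c b) * b)"
    by auto
  have "a \<in> rat_real.span B" using insert by auto
  then obtain u where u: "a = (\<Sum>b\<in>B. of_rat (u b) * b)"
    by (auto simp: rat_real.span_finite[OF assms(2)])
  define E where "E = (\<Prod>b\<in>B. snd (quotient_of (u b)))"
  have Epos: "E > 0" unfolding E_def by (intro prod_pos) (simp add: quotient_of_denom_pos')
  have "\<exists>k::int. of_int E * u b = of_int k" if "b \<in> B" for b
  proof -
    obtain p q where pq: "quotient_of (u b) = (p, q)" by fastforce
    then have uq: "u b = of_int p / of_int q" "q > 0" 
      using quotient_of_div quotient_of_denom_pos by blast+
    have "E = q * (\<Prod>b\<in>B-{b}. snd (quotient_of (u b)))"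
      unfolding E_def using that assms(2) pq by (simp add: prod.remove)
    then have "of_int E * u b = of_int ((\<Prod>b\<in>B-{b}. snd (quotient_of (u b))) * p)"
      using uq by (simp del: of_int_prod)
    then show ?thesis by blast
  qed
  then obtain k where k: "\<And>b. b \<in> B \<Longrightarrow> of_int E * u b = of_int (k b)" by metis
  have k': "real_of_int E * of_rat (u b) = of_int (k b)" if "b \<in> B" for b
    using k[OF that] by (metis of_rat_mult of_rat_of_int_eq)
  have Ea: "of_int E * a = (\<Sum>b\<in>B. of_int (k b) * b)"
    unfolding u sum_distrib_left by (intro sum.cong) (simp_all add: k' flip: mult.assoc)
  show ?case
  proof (intro exI[of _ "D * E"] conjI ballI)
    show "D * E > 0" using D Epos by simp
    fix x assume "x \<in> insert a A"
    then consider "x = a" | "x \<in> A" by blast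
    then show "\<exists>c::real \<Rightarrow> int. of_int (D * E) * x = (\<Sum>b\<in>B. of_int (c b) * b)"
    proof cases
      case 1
      have "of_int (D * E) * x = of_int D * (\<Sum>b\<in>B. of_int (k b) * b)"
        using Ea by (simp add: 1 mult.assoc)
      then show ?thesis
        by (intro exI[of _ "\<lambda>b. D * k b"]) (simp add: sum_distrib_left mult.assoc)
    next
      case 2
      then obtain c where c: "of_int D * x = (\<Sum>b\<in>B. of_int (c b) * b)" using D by blast
      have "of_int (D * E) * x = of_int E * (\<Sum>b\<in>B. of_int (c b) * b)"
        using c by (simp add: mult_ac)
      then show ?thesis
        by (intro exI[of _ "\<lambda>b. E * c b"]) (simp add: sum_distrib_left mult.assoc)
    qed
  qed
qed

text \<open>By the exchange lemma, discarding at most \<open>card A\<close> elements of \<open>X\<close> makes the rest independent of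
  \<open>A\<close> over the rationals, so Kronecker's theorem controls \<open>X\<close> and \<open>A\<close> separately.\<close>

lemma bohr_approx_up_to_few:
  fixes X A :: "real set" and n0 :: int
  assumes "finite X" "finite A" "1 \<notin> X" and ind: "rat_real.independent (insert 1 X)" and "\<epsilon> > 0"
  shows "\<exists>n::int. (\<forall>a\<in>A. \<exists>m::int. \<bar>of_int (n - n0) * a - of_int m\<bar> < \<epsilon>) \<and>
     card {x\<in>X. \<not> (\<exists>m::int. \<bar>of_int n * x - of_int m\<bar> < \<epsilon>)} \<le> card A"
proof -
  obtain B X' where BX: "B \<subseteq> A" "X' \<subseteq> X" "1 \<notin> B \<union> X'" "B \<inter> X' = {}"
    "rat_real.independent (insert 1 (B \<union> X'))" "A \<subseteq> rat_real.span (insert 1 B)"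
    "card (X - X') \<le> card A"
    using rat_independent_exchange[OF assms(1-4)] by metis
  have fin: "finite B" "finite X'" using BX assms finite_subset by blast+
  obtain D c where D: "D > 0" and
    c: "\<And>a. a \<in> A \<Longrightarrow> of_int D * a = (\<Sum>b\<in>insert 1 B. of_int ((c::real\<Rightarrow>real\<Rightarrow>int) a b) * b)"
    using rat_span_common_denominator[OF assms(2) _ BX(6)] fin by (metis finite_insert)
  \<comment> \<open>\<open>K\<close> bounds the factors by which an error at a basis element can
    grow: \<open>D\<close> for elements of \<open>X'\<close>, the coefficient sums for elements of
    \<open>A\<close>.\<close>
  define K where "K = real_of_int D + (\<Sum>a\<in>A. \<Sum>b\<in>B. \<bar>real_of_int (c a b)\<bar>)"
  have Kc: "(\<Sum>b\<in>B. \<bar>real_of_int (c a b)\<bar>) < K" if "a \<in> A" for a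
  proof -
    have "(\<Sum>b\<in>B. \<bar>real_of_int (c a b)\<bar>) \<le> (\<Sum>a\<in>A. \<Sum>b\<in>B. \<bar>real_of_int (c a b)\<bar>)"
      by (rule member_le_sum) (use that assms in \<open>auto intro: sum_nonneg\<close>)
    then show ?thesis using D by (simp add: K_def)
  qed
  have KD: "real_of_int D \<le> K" by (auto simp: K_def intro!: sum_nonneg)
  then have K: "K > 0" using D by linarith
  \<comment> \<open>The time will be \<open>n = n0 + D * t\<close>. Target 0 on \<open>B\<close>
    makes \<open>(n - n0) * a\<close> nearly an integer for \<open>a\<close> in \<open>A\<close>;
    target \<open>- n0 * x / D\<close> makes \<open>n * x\<close> nearly an integer for
    \<open>x\<close> in \<open>X'\<close>.\<close>
  define \<beta> where "\<beta> = (\<lambda>b. if b \<in> B then 0 else - of_int n0 * b / of_int D)"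
  have "\<exists>t::int. \<forall>b\<in>B \<union> X'. \<exists>m::int. \<bar>of_int t * b - of_int m - \<beta> b\<bar> < \<epsilon> / K"
    by (rule kronecker_independent) (use fin BX K \<open>\<epsilon> > 0\<close> in auto)
  then obtain t where "\<And>b. b \<in> B \<union> X' \<Longrightarrow> \<exists>m::int. \<bar>of_int t * b - of_int m - \<beta> b\<bar> < \<epsilon> / K"
    by blast
  then obtain m where m: "\<And>b. b \<in> B \<union> X' \<Longrightarrow> \<bar>of_int t * b - of_int (m b) - \<beta> b\<bar> < \<epsilon> / K" by metis
  define n where "n = n0 + D * t"
  show ?thesis
  proof (rule exI[of _ n], intro conjI ballI)
    fix a assume a: "a \<in> A"
    have "of_int (n - n0) * a = of_int t * (\<Sum>b\<in>insert 1 B. of_int (c a b) * b)"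
      using c[OF a] by (simp add: n_def)
    \<comment> \<open>The basis element 1 contributes an exact integer; only \<open>B\<close>
      contributes an error.\<close>
    also have "\<dots> = of_int (t * c a 1) + (\<Sum>b\<in>B. of_int (c a b) * (of_int t * b))"
      using fin BX(3) by (simp add: sum_distrib_left algebra_simps)
    finally have eq: "of_int (n - n0) * a - of_int (t * c a 1 + (\<Sum>b\<in>B. c a b * m b))
       = (\<Sum>b\<in>B. of_int (c a b) * (of_int t * b - of_int (m b)))"
      by (simp add: right_diff_distrib sum_subtractf)
    have "\<bar>\<Sum>b\<in>B. of_int (c a b) * (of_int t * b - of_int (m b))\<bar>
       \<le> (\<Sum>b\<in>B. \<bar>of_int (c a b)\<bar> * (\<epsilon> / K))"
    proof (intro order_trans[OF sum_abs] sum_mono)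
      fix b assume "b \<in> B"
      then have "\<bar>of_int t * b - of_int (m b)\<bar> \<le> \<epsilon> / K"
        using m[of b] by (simp add: \<beta>_def)
      then show "\<bar>of_int (c a b) * (of_int t * b - of_int (m b))\<bar> \<le> \<bar>of_int (c a b)\<bar> * (\<epsilon> / K)"
        unfolding abs_mult by (intro mult_left_mono) auto
    qed
    also have "\<dots> = (\<Sum>b\<in>B. \<bar>of_int (c a b)\<bar>) * (\<epsilon> / K)" by (rule sum_distrib_right[symmetric])
    also have "\<dots> < K * (\<epsilon> / K)"
      using Kc[OF a] K \<open>\<epsilon> > 0\<close> by (intro mult_strict_right_mono) auto
    also have "\<dots> = \<epsilon>" using K by simp
    finally show "\<exists>m::int. \<bar>of_int (n - n0) * a - of_int m\<bar> < \<epsilon>" using eq by metis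
  next
    have "\<exists>k::int. \<bar>of_int n * x - of_int k\<bar> < \<epsilon>" if "x \<in> X'" for x
    proof (intro exI[of _ "D * m x"])
      have "x \<notin> B" using that BX by auto
      then have "of_int n * x - of_int (D * m x) = of_int D * (of_int t * x - of_int (m x) - \<beta> x)"
        using D by (simp add: n_def \<beta>_def field_simps)
      moreover have "\<bar>of_int D * (of_int t * x - of_int (m x) - \<beta> x)\<bar> < \<epsilon>"
      proof -
        have "\<bar>of_int D * (of_int t * x - of_int (m x) - \<beta> x)\<bar> < of_int D * (\<epsilon> / K)"
          using mult_strict_left_mono[OF m[of x], of "of_int D"] that D by (simp add: abs_mult)
        also have "\<dots> \<le> K * (\<epsilon> / K)" using KD K \<open>\<epsilon> > 0\<close> by (intro mult_right_mono) auto
        finally show ?thesis using K by simp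
      qed
      ultimately show "\<bar>of_int n * x - of_int (D * m x)\<bar> < \<epsilon>" by simp
    qed
    then have "{x\<in>X. \<not> (\<exists>m::int. \<bar>of_int n * x - of_int m\<bar> < \<epsilon>)} \<subseteq> X - X'" by auto
    then show "card {x\<in>X. \<not> (\<exists>m::int. \<bar>of_int n * x - of_int m\<bar> < \<epsilon>)} \<le> card A"
      using BX(7) assms(1) by (meson card_mono finite_Diff order_trans)
  qed
qed

section \<open>Finitely many times serving all frequencies\<close>

lemma compact_unit_cube: "compact {\<alpha> :: nat \<Rightarrow> real. \<forall>i. \<alpha> i \<in> {0..1}}"
proof -
  have "compactin (product_topology (\<lambda>_. euclidean) UNIV) (PiE UNIV (\<lambda>_::nat. {0..1::real}))"
    by (subst compactin_PiE) auto
  moreover have "PiE UNIV (\<lambda>_::nat. {0..1::real}) = {\<alpha>. \<forall>i. \<alpha> i \<in> {0..1}}" by auto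
  ultimately show ?thesis by (simp add: euclidean_product_topology)
qed

text \<open>For a fixed \<open>n\<close> the frequency vectors it serves form an open set
  \<open>U n\<close>, because finitely many coordinates are involved; by
  \<open>bohr_approx_up_to_few\<close> the sets with \<open>n\<close> in \<open>G\<close> cover
  everything. Compactness of the unit cube leaves finitely many \<open>n\<close>, and reducing
  frequencies modulo 1 brings every vector into the cube.\<close>

lemma finite_bohr_approx_up_to_few:
  fixes X :: "real set" and n0 :: int and d :: nat
  assumes "finite X" "1 \<notin> X" and ind: "rat_real.independent (insert 1 X)" and "\<epsilon> > 0" "\<delta> > 0"
  obtains S :: "int set" where "finite S"
    "\<And>\<alpha>::nat\<Rightarrow>real. \<exists>n\<in>S. \<forall>i<d. \<exists>m::int. \<bar>of_int (n - n0) * \<alpha> i - of_int m\<bar> < \<delta>"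
    "\<And>n. n \<in> S \<Longrightarrow> card {x\<in>X. \<not> (\<exists>m::int. \<bar>of_int n * x - of_int m\<bar> < \<epsilon>)} \<le> d"
proof -
  define G where "G = {n. card {x\<in>X. \<not> (\<exists>m::int. \<bar>of_int n * x - of_int m\<bar> < \<epsilon>)} \<le> d}"
  define U where "U = (\<lambda>n::int. {\<alpha>::nat\<Rightarrow>real. \<forall>i<d. \<exists>m::int. \<bar>of_int (n - n0) * \<alpha> i - of_int m\<bar> < \<delta>})"
  have op: "open (U n)" for n
  proof -
    have "U n = {\<alpha>. \<forall>i\<in>{..<d}. \<alpha> i \<in> (\<Union>m::int. {x. \<bar>of_int (n - n0) * x - of_int m\<bar> < \<delta>})}"
      by (auto simp: U_def)
    moreover have "open (\<Union>m::int. {x. \<bar>of_int (n - n0) * x - of_int m\<bar> < \<delta>})"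
      by (intro open_UN ballI open_Collect_less continuous_intros)
    ultimately show ?thesis
      using product_topology_basis'[of "{..<d}" "\<lambda>_. (\<Union>m::int. {x. \<bar>of_int (n - n0) * x - of_int m\<bar> < \<delta>})" "\<lambda>i. i"]
      by simp
  qed
  have cov: "\<exists>n\<in>G. \<alpha> \<in> U n" for \<alpha>
  proof -
    obtain n :: int where n: "\<forall>a\<in>\<alpha> ` {..<d}. \<exists>m::int. \<bar>of_int (n - n0) * a - of_int m\<bar> < min \<epsilon> \<delta>"
      "card {x\<in>X. \<not> (\<exists>m::int. \<bar>of_int n * x - of_int m\<bar> < min \<epsilon> \<delta>)} \<le> card (\<alpha> ` {..<d})"
      using bohr_approx_up_to_few[of X "\<alpha> ` {..<d}" "min \<epsilon> \<delta>" n0] assms by auto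
    have "card {x\<in>X. \<not> (\<exists>m::int. \<bar>of_int n * x - of_int m\<bar> < \<epsilon>)} \<le> 
       card {x\<in>X. \<not> (\<exists>m::int. \<bar>of_int n * x - of_int m\<bar> < min \<epsilon> \<delta>)}"
      by (rule card_mono) (use assms in auto)
    also have "\<dots> \<le> d" using n(2) card_image_le[of "{..<d}" \<alpha>] by simp
    finally have "n \<in> G" by (simp add: G_def)
    moreover have "\<alpha> \<in> U n" using n(1) by (fastforce simp: U_def)
    ultimately show ?thesis by blast
  qed
  then have "{\<alpha>. \<forall>i. \<alpha> i \<in> {0..1}} \<subseteq> (\<Union>n\<in>G. U n)" by blast
  then obtain S where S: "S \<subseteq> G" "finite S" "{\<alpha>. \<forall>i. \<alpha> i \<in> {0..1}} \<subseteq> (\<Union>n\<in>S. U n)"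
    using compactE_image[OF compact_unit_cube, of G U] op by metis
  show thesis
  proof (rule that[OF S(2)])
    fix \<alpha> :: "nat \<Rightarrow> real"
    have "(\<lambda>i. frac (\<alpha> i)) \<in> {\<alpha>. \<forall>i. \<alpha> i \<in> {0..1}}"
      by (auto simp: less_imp_le frac_lt_1)
    then obtain n where n: "n \<in> S" "(\<lambda>i. frac (\<alpha> i)) \<in> U n" using S(3) by (meson UN_E subsetD)
    have "\<exists>m::int. \<bar>of_int (n - n0) * \<alpha> i - of_int m\<bar> < \<delta>" if "i < d" for i
    proof -
      obtain m::int where m: "\<bar>of_int (n - n0) * frac (\<alpha> i) - of_int m\<bar> < \<delta>"
        using n(2) \<open>i < d\<close> by (auto simp: U_def)
      \<comment> \<open>The integer part of the frequency is absorbed into the nearby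
        integer.\<close>
      have "of_int (n - n0) * frac (\<alpha> i) - of_int m = 
        of_int (n - n0) * \<alpha> i - of_int (m + (n - n0) * \<lfloor>\<alpha> i\<rfloor>)"
        by (simp add: frac_def algebra_simps)
      then show ?thesis using m by metis
    qed
    then show "\<exists>n\<in>S. \<forall>i<d. \<exists>m::int. \<bar>of_int (n - n0) * \<alpha> i - of_int m\<bar> < \<delta>" using n(1) by blast
  next
    fix n assume "n \<in> S"
    then show "card {x\<in>X. \<not> (\<exists>m::int. \<bar>of_int n * x - of_int m\<bar> < \<epsilon>)} \<le> d"
      using S(1) by (auto simp: G_def)
  qed
qed

section \<open>Rationally independent angles in an interval\<close>

lemma countable_rat_span: "finite B \<Longrightarrow> countable (rat_real.span B)"
proof (induction B rule: finite_induct)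
  case empty
  then show ?case by simp
next
  case (insert b B)
  have "rat_real.span (insert b B) = (\<Union>k. \<Union>y\<in>rat_real.span B. {y + of_rat k * b})"
  proof safe
    fix x assume "x \<in> rat_real.span (insert b B)"
    then obtain k where "x - of_rat k * b \<in> rat_real.span B"
      by (auto simp: rat_real.span_insert)
    then show "x \<in> (\<Union>k. \<Union>y\<in>rat_real.span B. {y + of_rat k * b})"
      by (intro UN_I[of k] UN_I[of "x - of_rat k * b"]) auto
  next
    fix k y assume "y \<in> rat_real.span B"
    then show "y + of_rat k * b \<in> rat_real.span (insert b B)"
      by (auto simp: rat_real.span_insert intro!: exI[of _ k])
  qed
  then show ?case using insert by (auto intro!: countable_UN)
qed

text \<open>Angles are added one at a time: the rational span of 1 and those found so far is
  countable, whereas the interval is not.\<close>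

lemma rat_independent_in_interval:
  fixes a b :: real
  assumes "a < b"
  obtains X where "finite X" "card X = M" "X \<subseteq> {a<..<b}" "1 \<notin> X" "rat_real.independent (insert 1 X)"
proof -
  have "\<exists>X. finite X \<and> card X = M \<and> X \<subseteq> {a<..<b} \<and> 1 \<notin> X \<and> rat_real.independent (insert 1 X)"
  proof (induction M)
    case 0
    show ?case by (rule exI[of _ "{}"]) simp
  next
    case (Suc M)
    then obtain X where X: "finite X" "card X = M" "X \<subseteq> {a<..<b}" "1 \<notin> X" "rat_real.independent (insert 1 X)"
      by blast
    have "uncountable ({a<..<b} - rat_real.span (insert 1 X))"
      using countable_rat_span[of "insert 1 X"] X(1) uncountable_open_interval[of a b] assms
      by (intro uncountable_minus_countable) auto
    then obtain x where x: "x \<in> {a<..<b}" "x \<notin> rat_real.span (insert 1 X)"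
      by (metis DiffE all_not_in_conv countable_empty)
    then have "x \<notin> insert 1 X" using rat_real.span_base by blast
    moreover have "rat_real.independent (insert x (insert 1 X))"
      using x X by (simp add: rat_real.independent_insertI)
    ultimately show ?case
      using X x by (intro exI[of _ "insert x X"]) (auto simp: insert_commute)
  qed
  then show thesis using that by blast
qed



section \<open>Periodic approximations\<close>

lemma int_div_bounds:
  fixes u r L :: int
  assumes "0 < r" "0 \<le> u" "u < L * r"
  shows "0 \<le> u div r \<and> u div r < L"
proof -
  have "u div r < L"
  proof (rule ccontr)
    assume "\<not> u div r < L"
    then have "L * r \<le> u div r * r" using assms by (intro mult_right_mono) auto
    moreover have "u div r * r \<le> u" using pos_mod_sign[OF assms(1), of u] div_mult_mod_eq[of u r] by linarith
    ultimately show False using assms by linarith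
  qed
  then show ?thesis using assms by (simp add: pos_imp_zdiv_nonneg_iff)
qed

lemma card_int_blocks:
  fixes M q :: int
  assumes "0 < q" "0 \<le> M"
  shows "card {p\<in>{0..<M * q}. P p} = (\<Sum>j\<in>{0..<M}. card {t\<in>{0..<q}. P (j * q + t)})"
proof -
  have "bij_betw (\<lambda>(j, t). j * q + t) (SIGMA j:{0..<M}. {t\<in>{0..<q}. P (j * q + t)}) {p\<in>{0..<M * q}. P p}"
  proof (rule bij_betw_byWitness[where f' = "\<lambda>p. (p div q, p mod q)"])
    show "(\<lambda>(j, t). j * q + t) ` (SIGMA j:{0..<M}. {t\<in>{0..<q}. P (j * q + t)}) \<subseteq> {p\<in>{0..<M * q}. P p}"
    proof (intro subsetI)
      fix x assume "x \<in> (\<lambda>(j, t). j * q + t) ` (SIGMA j:{0..<M}. {t\<in>{0..<q}. P (j * q + t)})"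
      then obtain j t where x: "x = j * q + t" "P (j * q + t)" and *: "0 \<le> j" "j < M" "0 \<le> t" "t < q" by auto
      then have "j * q + t < (j + 1) * q" by (simp add: algebra_simps)
      also have "\<dots> \<le> M * q" using * by (intro mult_right_mono) auto
      finally show "x \<in> {p\<in>{0..<M * q}. P p}" using * x assms by simp
    qed
    show "(\<lambda>p. (p div q, p mod q)) ` {p\<in>{0..<M * q}. P p} \<subseteq> (SIGMA j:{0..<M}. {t\<in>{0..<q}. P (j * q + t)})"
    proof (intro subsetI)
      fix x assume "x \<in> (\<lambda>p. (p div q, p mod q)) ` {p\<in>{0..<M * q}. P p}"
      then obtain p where x: "x = (p div q, p mod q)" and p: "0 \<le> p" "p < M * q" "P p" by auto
      have "p div q * q + p mod q = p" by simp
      moreover have "0 \<le> p div q \<and> p div q < M" using p assms by (intro int_div_bounds) auto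
      ultimately show "x \<in> (SIGMA j:{0..<M}. {t\<in>{0..<q}. P (j * q + t)})"
        unfolding x using p assms by (simp add: pos_imp_zdiv_nonneg_iff)
    qed
  qed (use assms in \<open>auto simp: div_pos_pos_trivial\<close>)
  then show ?thesis
    by (subst bij_betw_same_card[symmetric])
      (auto intro!: card_SigmaI finite_subset[OF _ finite_atLeastLessThan_int[of 0 q]])
qed

text \<open>Within each of the \<open>L\<close> blocks of \<open>r\<close> consecutive numbers, at
  most the last \<open>e\<close> residues (the first \<open>- e\<close> if \<open>e\<close> is
  negative) leave the block when \<open>e\<close> is added.\<close>

lemma card_add_outside_residues:
  fixes L r e :: int
  assumes "0 < r" "0 \<le> L"
  shows "int (card {u\<in>{0..<L * r}. u mod r + e \<notin> {0..<r}}) \<le> L * \<bar>e\<bar>"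
proof -
  have "{t\<in>{0..<r}. t + e \<notin> {0..<r}} \<subseteq> (if e \<ge> 0 then {r - e..<r} else {0..<-e})" by auto
  then have "card {t\<in>{0..<r}. t + e \<notin> {0..<r}} \<le> card (if e \<ge> 0 then {r - e..<r} else {0..<-e})"
    by (intro card_mono) auto
  also have "\<dots> = nat \<bar>e\<bar>" by auto
  finally have c: "card {t\<in>{0..<r}. t + e \<notin> {0..<r}} \<le> nat \<bar>e\<bar>" .
  have "card {u\<in>{0..<L * r}. u mod r + e \<notin> {0..<r}} = 
    (\<Sum>j\<in>{0..<L}. card {t\<in>{0..<r}. (j * r + t) mod r + e \<notin> {0..<r}})"
    by (rule card_int_blocks) (use assms in auto)
  also have "\<dots> = (\<Sum>j\<in>{0..<L}. card {t\<in>{0..<r}. t + e \<notin> {0..<r}})"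
    by (intro sum.cong arg_cong[where f = card]) auto
  also have "\<dots> \<le> nat L * nat \<bar>e\<bar>" using c by simp
  finally have "int (card {u\<in>{0..<L * r}. u mod r + e \<notin> {0..<r}}) \<le> int (nat L * nat \<bar>e\<bar>)"
    by (simp only: of_nat_le_iff)
  then show ?thesis using assms by simp
qed

section \<open>Rotations of \<open>\<int>/q\<close> read through arcs of length
  \<open>r\<close>\<close>

lemma bij_betw_mult_mod:
  fixes a q :: int
  assumes "0 < q" "coprime a q"
  shows "bij_betw (\<lambda>t. (t * a) mod q) {0..<q} {0..<q}"
proof -
  have inj: "inj_on (\<lambda>t. (t * a) mod q) {0..<q}"
  proof (rule inj_onI)
    fix x y assume xy: "x \<in> {0..<q}" "y \<in> {0..<q}" "(x * a) mod q = (y * a) mod q"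
    then have "q dvd (x - y) * a" by (simp add: mod_eq_dvd_iff left_diff_distrib)
    then have "q dvd x - y" using assms(2) by (simp add: coprime_commute coprime_dvd_mult_left_iff)
    then have "x mod q = y mod q" by (simp add: mod_eq_dvd_iff)
    then show "x = y" using xy by simp
  qed
  moreover have "(\<lambda>t. (t * a) mod q) ` {0..<q} \<subseteq> {0..<q}" using assms by auto
  ultimately show ?thesis
    by (simp add: bij_betw_def endo_inj_surj)
qed

lemma card_mult_mod:
  fixes a q :: int
  assumes "0 < q" "coprime a q"
  shows "card {t\<in>{0..<q}. P ((t * a) mod q)} = card {u\<in>{0..<q}. P u}"
  by (rule bij_betw_same_card, rule bij_betw_Collect[OF bij_betw_mult_mod[OF assms]]) simp

text \<open>The symbol of a point of \<open>\<int>/q\<close> is the number of its arc among the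
  \<open>L\<close> arcs of length \<open>r\<close>. Time \<open>n\<close> moves every orbit point by
  \<open>c\<close> whole arcs and a drift \<open>e\<close>, so the symbol advances by exactly
  \<open>c\<close> unless the drift carries the point across an end of its arc. Such points are
  counted by \<open>card_add_outside_residues\<close>, as the orbit visits every residue
  once.\<close>

lemma card_shift_rotation:
  fixes a n c e z L r q :: int
  assumes "0 < r" "0 < L" "q = L * r" "coprime a q" and e: "n * a = c * r + e + q * z"
  shows "int (card {t\<in>{0..<q}. (((t + n) * a) mod q) div r \<noteq> (((t * a) mod q) div r + c) mod L}) \<le> L * \<bar>e\<bar>"
proof -
  have q: "0 < q" using assms by simp
  have key: "(((t + n) * a) mod q) div r = (((t * a) mod q) div r + c) mod L"
    if "((t * a) mod q) mod r + e \<in> {0..<r}" for t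
  proof -
    define u where "u = (t * a) mod q"
    have "((t + n) * a) mod q = (t * a + (c * r + e)) mod q"
      by (simp add: distrib_right e flip: add.assoc)
    also have "\<dots> = (u + (c * r + e)) mod q" by (simp add: u_def mod_add_left_eq)
    also have "u + (c * r + e) = (u div r + c) * r + (u mod r + e)"
      using div_mult_mod_eq[of u r] by (simp add: algebra_simps)
    also have "\<dots> mod q = ((u div r + c) mod L) * r + (u mod r + e)"
    proof -
      \<comment> \<open>Reducing the arc number modulo \<open>L\<close> amounts to reducing the
        point modulo \<open>q = L * r\<close>.\<close>
      define k where "k = u div r + c"
      have "(L * x + y) * r + w = (y * r + w) + q * x" for x y w
        by (simp add: assms(3) algebra_simps)
      from this[of "k div L" "k mod L" "u mod r + e"]
      have "k * r + (u mod r + e) = (k mod L * r + (u mod r + e)) + q * (k div L)" by simp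
      moreover have "0 \<le> k mod L * r + (u mod r + e)" using that assms by (simp add: u_def)
      moreover have "k mod L * r + (u mod r + e) < q"
      proof -
        have "k mod L \<le> L - 1" using pos_mod_bound[OF assms(2), of k] by linarith
        then have "k mod L * r \<le> (L - 1) * r" using assms by (intro mult_right_mono) auto
        then show ?thesis using that by (simp add: u_def assms(3) algebra_simps)
      qed
      ultimately show ?thesis
        unfolding k_def by (simp only: mod_mult_self2 mod_pos_pos_trivial)
    qed
    finally have "((t + n) * a) mod q = ((u div r + c) mod L) * r + (u mod r + e)" .
    then show ?thesis using that assms(1) by (simp add: u_def div_pos_pos_trivial)
  qed
  have "card {t\<in>{0..<q}. (((t + n) * a) mod q) div r \<noteq> (((t * a) mod q) div r + c) mod L}
    \<le> card {t\<in>{0..<q}. ((t * a) mod q) mod r + e \<notin> {0..<r}}"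
    using key by (intro card_mono) (auto intro: finite_subset[OF _ finite_atLeastLessThan_int[of 0 q]])
  also have "\<dots> = card {u\<in>{0..<q}. u mod r + e \<notin> {0..<r}}"
    by (rule card_mult_mod[OF q assms(4)])
  finally show ?thesis
    using card_add_outside_residues[of r L e] assms by simp
qed

text \<open>Position \<open>j q + t\<close> carries the symbol visited at time \<open>t\<close> by the rotation
  by \<open>a j / q\<close>.\<close>

definition block_code :: "int \<Rightarrow> int \<Rightarrow> (int \<Rightarrow> int) \<Rightarrow> int \<Rightarrow> int" where
  "block_code q r a p = ((p * a (p div q)) mod q) div r"

lemma block_code_block:
  assumes "0 < q" "0 \<le> t" "t < q"
  shows "block_code q r a (j * q + t) = ((t * a j) mod q) div r"
proof -
  have "(j * q + t) div q = j" using assms by (simp add: div_pos_pos_trivial)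
  moreover have "((j * q + t) * a j) mod q = (t * a j) mod q"
    by (simp add: distrib_right mult.assoc mult.left_commute[of j q])
  ultimately show ?thesis by (simp add: block_code_def)
qed

text \<open>In every block the orbit runs once through all residues modulo \<open>q\<close>, and
  each symbol stands for an arc of \<open>r\<close> of them.\<close>

lemma card_block_code_fiber:
  fixes L r q M i :: int
  assumes "0 < r" "0 < L" "q = L * r" "0 \<le> M" "\<And>j. coprime (a j) q" "0 \<le> i" "i < L"
  shows "int (card {p\<in>{0..<M * q}. block_code q r a p = i}) = M * r"
proof -
  have q: "0 < q" using assms by simp
  have "card {p\<in>{0..<M * q}. block_code q r a p = i} = 
     (\<Sum>j\<in>{0..<M}. card {t\<in>{0..<q}. block_code q r a (j * q + t) = i})"
    by (rule card_int_blocks) (use q assms in auto)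
  also have "\<dots> = (\<Sum>j\<in>{0..<M}. nat r)"
  proof (rule sum.cong)
    fix j
    have "{t\<in>{0..<q}. block_code q r a (j * q + t) = i} = {t\<in>{0..<q}. ((t * a j) mod q) div r = i}"
      using block_code_block[OF q] by auto
    also have "card \<dots> = card {u\<in>{0..<q}. u div r = i}"
      by (rule card_mult_mod[OF q assms(5)])
    also have "{u\<in>{0..<q}. u div r = i} = {i * r..<i * r + r}"
    proof safe
      fix u assume "u \<in> {i * r..<i * r + r}"
      define w where "w = u - i * r"
      have w: "u = i * r + w" "0 \<le> w" "w < r"
        using \<open>u \<in> {i * r..<i * r + r}\<close> by (auto simp: w_def)
      then show "u div r = i" by (simp add: div_pos_pos_trivial)
      have "i * r + r \<le> L * r" using assms mult_right_mono[of "i + 1" L r] by (simp add: algebra_simps)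
      moreover have "0 \<le> i * r" using assms by simp
      ultimately show "u \<in> {0..<q}" using w assms(3) by (simp del: mult_less_cancel_right mult_le_cancel_right)
    next
      fix u assume "u \<in> {0..<q}" 
      then show "u \<in> {u div r * r..<u div r * r + r}"
        using div_mult_mod_eq[of u r] pos_mod_bound[OF assms(1), of u] pos_mod_sign[OF assms(1), of u]
        unfolding atLeastLessThan_iff by linarith
    qed
    finally show "card {t\<in>{0..<q}. block_code q r a (j * q + t) = i} = nat r" by simp
  qed simp
  finally show ?thesis using assms by simp
qed

text \<open>Three kinds of failure are counted: at most \<open>\<bar>n\<bar>\<close> offsets per
  block that time \<open>n\<close> carries out of their block, at most \<open>L * E\<close> drift
  errors per block with index in \<open>G\<close>, and all \<open>q\<close> positions of each
  remaining block. The case \<open>c = n\<close> will give near equivariance, \<open>c = 0\<close>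
  near invariance.\<close>

lemma card_block_code_shift:
  fixes L r q M n c E :: int
  assumes "0 < r" "0 < L" "q = L * r" "0 < M" "\<And>j. coprime (a j) q" "G \<subseteq> {0..<M}" "0 \<le> E"
    and G: "\<And>j. j \<in> G \<Longrightarrow> \<exists>z. \<bar>n * a j - c * r - q * z\<bar> \<le> E"
  shows "int (card {p\<in>{0..<M * q}. block_code q r a ((p + n) mod (M * q)) \<noteq> (block_code q r a p + c) mod L})
    \<le> M * \<bar>n\<bar> + M * (L * E) + (M - int (card G)) * q"
proof -
  have q: "0 < q" using assms by simp
  define B where "B j = {t\<in>{0..<q}. block_code q r a ((j * q + t + n) mod (M * q)) 
     \<noteq> (block_code q r a (j * q + t) + c) mod L}" for j
  have fG: "finite G" using assms(6) finite_subset by blast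
  have good: "int (card (B j)) \<le> \<bar>n\<bar> + L * E" if j: "j \<in> G" for j
  proof -
    obtain z where z: "\<bar>n * a j - c * r - q * z\<bar> \<le> E" using G[OF j] by blast
    define e where "e = n * a j - c * r - q * z"
    have j': "0 \<le> j" "j < M" using j assms(6) by auto
    have "B j \<subseteq> {t\<in>{0..<q}. t + n \<notin> {0..<q}} \<union> 
       {t\<in>{0..<q}. (((t + n) * a j) mod q) div r \<noteq> (((t * a j) mod q) div r + c) mod L}"
    proof
      fix t assume t: "t \<in> B j"
      show "t \<in> {t\<in>{0..<q}. t + n \<notin> {0..<q}} \<union> 
       {t\<in>{0..<q}. (((t + n) * a j) mod q) div r \<noteq> (((t * a j) mod q) div r + c) mod L}"
      proof (cases "t + n \<in> {0..<q}")
        case True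
        have "j * q + q \<le> M * q" using j' q mult_right_mono[of "j + 1" M q] by (simp add: algebra_simps)
        moreover have "0 \<le> j * q" using j' q by simp
        ultimately have "(j * q + t + n) mod (M * q) = j * q + (t + n)"
          using True by (subst mod_pos_pos_trivial) auto
        then show ?thesis using t True q by (auto simp: B_def block_code_block)
      qed (use t in \<open>auto simp: B_def\<close>)
    qed
    then have "card (B j) \<le> card {t\<in>{0..<q}. t + n \<notin> {0..<q}} + 
       card {t\<in>{0..<q}. (((t + n) * a j) mod q) div r \<noteq> (((t * a j) mod q) div r + c) mod L}"
      by (intro order_trans[OF card_mono card_Un_le] finite_UnI) (assumption | rule finite_subset[OF _ finite_atLeastLessThan_int[of 0 q]] | auto)+
    moreover have "int (card {t\<in>{0..<q}. t + n \<notin> {0..<q}}) \<le> \<bar>n\<bar>"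
    proof -
      have "{t\<in>{0..<q}. t + n \<notin> {0..<q}} = {u\<in>{0..<1 * q}. u mod q + n \<notin> {0..<q}}"
        by auto
      then show ?thesis using card_add_outside_residues[of q 1 n] q by simp
    qed
    moreover have "int (card {t\<in>{0..<q}. (((t + n) * a j) mod q) div r \<noteq> (((t * a j) mod q) div r + c) mod L}) \<le> L * \<bar>e\<bar>"
      by (rule card_shift_rotation[OF assms(1-3,5), where z = z]) (simp add: e_def)
    moreover have "L * \<bar>e\<bar> \<le> L * E" using z assms by (simp add: e_def)
    ultimately show ?thesis by linarith
  qed
  have bad: "int (card (B j)) \<le> q" for j
  proof -
    have "card (B j) \<le> card {0..<q}" by (rule card_mono) (auto simp: B_def)
    then show ?thesis using q by simp
  qed
  have "int (card {p\<in>{0..<M * q}. block_code q r a ((p + n) mod (M * q)) \<noteq> (block_code q r a p + c) mod L})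
    = (\<Sum>j\<in>{0..<M}. int (card (B j)))"
    unfolding B_def by (subst card_int_blocks) (use q assms in auto)
  also have "\<dots> = (\<Sum>j\<in>G. int (card (B j))) + (\<Sum>j\<in>{0..<M} - G. int (card (B j)))"
    using assms(6) by (metis add.commute finite_atLeastLessThan_int sum.subset_diff)
  also have "\<dots> \<le> (\<Sum>j\<in>G. \<bar>n\<bar> + L * E) + (\<Sum>j\<in>{0..<M} - G. q)"
    by (intro add_mono sum_mono good bad)
  also have "\<dots> = int (card G) * (\<bar>n\<bar> + L * E) + (M - int (card G)) * q"
    using assms fG card_mono[of "{0..<M}" G] by (simp add: card_Diff_subset of_nat_diff)
  also have "int (card G) * (\<bar>n\<bar> + L * E) \<le> M * (\<bar>n\<bar> + L * E)"
    using card_mono[of "{0..<M}" G] assms by (intro mult_right_mono) auto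
  finally show ?thesis by (simp add: algebra_simps)
qed

text \<open>One level of the tower. Independent angles are needed to find the times
  \<open>S\<close>, rational ones to define \<open>\<phi>\<close>. So the number \<open>M\<close> of
  angles, the angles and then \<open>S\<close> are fixed first; only afterwards is the denominator
  \<open>q\<close> chosen, so large that up to the largest time in \<open>S\<close> the rounded
  angles \<open>a j / q\<close> behave like \<open>\<theta> j\<close>.\<close>

lemma periodic_approximation_stage:
  fixes L :: int and k :: nat and \<epsilon> :: real
  assumes L: "2 \<le> L" and k: "0 < k" and \<epsilon>: "0 < \<epsilon>"
  obtains S :: "int set" and R :: int and \<phi> :: "int \<Rightarrow> int" where
    "finite S" "2 \<le> R" "\<And>p. 0 \<le> \<phi> p \<and> \<phi> p < L"
    "\<And>i. 0 \<le> i \<Longrightarrow> i < L \<Longrightarrow> int (card {p\<in>{0..<L * R}. \<phi> p = i}) = R"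
    "\<And>n. \<bar>n\<bar> \<le> 2 * L \<Longrightarrow>
       real (card {p\<in>{0..<L * R}. \<phi> ((p + n) mod (L * R)) \<noteq> (\<phi> p + n) mod L}) \<le> \<epsilon> * of_int (L * R)"
    "\<And>n. n \<in> S \<Longrightarrow> \<bar>n\<bar> \<le> L * R"
    "\<And>n. n \<in> S \<Longrightarrow>
       real (card {p\<in>{0..<L * R}. \<phi> ((p + n) mod (L * R)) \<noteq> \<phi> p}) \<le> \<epsilon> * of_int (L * R)"
    "\<And>n0 (\<alpha>::nat\<Rightarrow>real). \<bar>n0\<bar> \<le> int k \<Longrightarrow>
       \<exists>n\<in>S. \<forall>i<k. \<exists>m::int. \<bar>of_int (n - n0) * \<alpha> i - of_int m\<bar> < 1 / real k"
proof -
  \<comment> \<open>Over \<open>2 * L\<close> steps an angle within \<open>\<eta>\<close> of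
    \<open>1 / L\<close>, rounding included, drifts by at most \<open>4 * L * \<eta> * q\<close>;
    over \<open>L\<close> arcs this spoils at most \<open>\<epsilon> * q / 2\<close> positions per
    block.\<close>
  define \<eta> where "\<eta> = \<epsilon> / (8 * of_int L ^ 2)"
  \<comment> \<open>For times in \<open>S\<close> half of the drift bound
    \<open>2 * \<epsilon>2 * q\<close> is for \<open>n * \<theta> j\<close> missing an integer and
    half for rounding; over \<open>L\<close> arcs it costs \<open>\<epsilon> * q / 4\<close>
    positions per block.\<close>
  define \<epsilon>2 where "\<epsilon>2 = \<epsilon> / (8 * of_int L)"
  have pos: "\<eta> > 0" "\<epsilon>2 > 0" using L \<epsilon> by (auto simp: \<eta>_def \<epsilon>2_def)
  \<comment> \<open>Each time in \<open>S\<close> may spoil \<open>k\<close> whole blocks; among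
    \<open>M\<close> blocks these are less than the share \<open>\<epsilon> / 4\<close>. The extra 1
    makes \<open>M\<close>, and hence \<open>R\<close>, at least 2.\<close>
  obtain M :: nat where "4 * real k / \<epsilon> + 1 < real M" using reals_Archimedean2 by blast
  moreover have "0 < 4 * real k / \<epsilon>" using k \<epsilon> by simp
  ultimately have M: "4 * real k / \<epsilon> < real M" and "1 < real M" by linarith+
  then have Mpos: "0 < M" and M2: "2 \<le> M" by simp_all
  obtain X where X: "finite X" "card X = M" "X \<subseteq> {1 / of_int L - \<eta><..<1 / of_int L + \<eta>}" "1 \<notin> X"
    "rat_real.independent (insert 1 X)"
    using rat_independent_in_interval[of "1 / of_int L - \<eta>" "1 / of_int L + \<eta>" M] pos by auto
  define few where "few n \<longleftrightarrow> card {x\<in>X. \<not> (\<exists>m::int. \<bar>of_int n * x - of_int m\<bar> < \<epsilon>2)} \<le> k" for n :: int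
  define near where "near n \<alpha> \<longleftrightarrow> (\<forall>i<k. \<exists>m::int. \<bar>of_int n * \<alpha> i - of_int m\<bar> < 1 / real k)"
    for n :: int and \<alpha> :: "nat \<Rightarrow> real"
  have "\<exists>S. finite S \<and> (\<forall>\<alpha>. \<exists>n\<in>S. near (n - n0) \<alpha>) \<and> (\<forall>n\<in>S. few n)" for n0
  proof -
    have "1 / real k > 0" using k by simp
    from finite_bohr_approx_up_to_few[OF X(1,4,5) pos(2) this, of k n0]
    obtain S where "finite S" "\<And>\<alpha>. \<exists>n\<in>S. near (n - n0) \<alpha>" "\<And>n. n \<in> S \<Longrightarrow> few n"
      unfolding near_def few_def by blast
    then show ?thesis by blast
  qed
  then obtain S0 where S0: "\<And>n0. finite (S0 n0)" "\<And>n0 \<alpha>. \<exists>n\<in>S0 n0. near (n - n0) \<alpha>"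
    "\<And>n0 n. n \<in> S0 n0 \<Longrightarrow> few n"
    by metis
  define S where "S = (\<Union>n0\<in>{- int k..int k}. S0 n0)"
  have finS: "finite S" using S0(1) by (simp add: S_def)
  define N where "N = Max (insert 1 (abs ` S))"
  have N: "1 \<le> N" "\<And>n. n \<in> S \<Longrightarrow> \<bar>n\<bar> \<le> N" using finS by (auto simp: N_def)
  \<comment> \<open>One summand for each of the five lower bounds on \<open>q\<close> derived
    below.\<close>
  define Q where "Q = 4 * of_int L / \<epsilon> + of_int L / \<eta> + of_int (N * L) / \<epsilon>2 + 4 * of_int N / \<epsilon> + of_int N"
  obtain s0 :: nat where "Q < of_int L ^ s0"
    using real_arch_pow[of "of_int L" Q] L by auto
  also have "real_of_int L ^ s0 \<le> of_int L ^ Suc s0" using L by (intro power_increasing) auto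
  finally have s0: "Q < of_int L ^ Suc s0" .
  define r where "r = L ^ s0"
  define q where "q = L * r"
  have r: "0 < r" and q: "0 < q" using L by (auto simp: r_def q_def)
  have qQ: "Q \<le> of_int q" using s0 by (simp add: q_def r_def)
  have Qpos: "0 < of_int L / \<epsilon>" "0 < of_int L / \<eta>" "0 < of_int (N * L) / \<epsilon>2" "0 < of_int N / \<epsilon>" "0 < real_of_int N"
    using L \<epsilon> pos N(1) by auto
  have q1: "4 * of_int L \<le> \<epsilon> * of_int q" and q2: "of_int L \<le> \<eta> * of_int q"
    and q3: "of_int (N * L) \<le> \<epsilon>2 * of_int q" and q4: "4 * of_int N \<le> \<epsilon> * of_int q" and q5: "N \<le> q"
  proof -
    have "4 * of_int L / \<epsilon> \<le> of_int q" "of_int L / \<eta> \<le> of_int q" "of_int (N * L) / \<epsilon>2 \<le> of_int q"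
      "4 * of_int N / \<epsilon> \<le> of_int q" "real_of_int N \<le> of_int q"
      using qQ Qpos unfolding Q_def times_divide_eq_right[symmetric] by linarith+
    then show "4 * of_int L \<le> \<epsilon> * of_int q" "of_int L \<le> \<eta> * of_int q"
      "of_int (N * L) \<le> \<epsilon>2 * of_int q" "4 * of_int N \<le> \<epsilon> * of_int q" "N \<le> q"
      using \<epsilon> pos by (simp_all add: pos_divide_le_eq mult.commute)
  qed
  obtain f where f: "bij_betw f {..<M} X"
    using ex_bij_betw_nat_finite[OF X(1)] X(2) by (auto simp: lessThan_atLeast0)
  define \<theta> where "\<theta> j = f (nat j)" for j :: int
  \<comment> \<open>Rounding \<open>\<theta> j * q\<close> to a number congruent to 1 modulo
    \<open>L\<close> ensures coprimality and costs an error of at most \<open>L\<close>.\<close>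
  define a where "a j = L * \<lfloor>\<theta> j * of_int q / of_int L\<rfloor> + 1" for j
  have cop: "coprime (a j) q" for j
  proof -
    have "coprime (a j) L" unfolding a_def by (metis add.commute coprime_1_left gcd_add_mult coprime_iff_gcd_eq_1 gcd.commute mult.commute)
    then show ?thesis by (simp add: q_def r_def)
  qed
  have a\<theta>: "\<bar>of_int (a j) - \<theta> j * of_int q\<bar> \<le> of_int L" for j
  proof -
    define y where "y = \<theta> j * of_int q / of_int L"
    have y: "\<theta> j * of_int q = of_int L * y" using L by (simp add: y_def)
    have "of_int (a j) - \<theta> j * of_int q = 1 - of_int L * (y - of_int \<lfloor>y\<rfloor>)"
      unfolding y by (simp add: a_def y_def algebra_simps)
    moreover have "0 \<le> of_int L * (y - of_int \<lfloor>y\<rfloor>)" "of_int L * (y - of_int \<lfloor>y\<rfloor>) \<le> of_int L * 1"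
      using L by (auto intro!: mult_left_mono) linarith
    ultimately show ?thesis using L by linarith
  qed
  have \<theta>X: "\<theta> j \<in> X" if "j \<in> {0..<int M}" for j
    using f that by (auto simp: \<theta>_def bij_betw_def)
  \<comment> \<open>One error \<open>\<eta> * q\<close> because \<open>\<theta> j\<close> is close
    to \<open>1 / L = r / q\<close>, and a rounding error \<open>L \<le> \<eta> * q\<close>.\<close>
  have ar: "\<bar>of_int (a j - r)\<bar> \<le> 2 * \<eta> * of_int q" if "j \<in> {0..<int M}" for j
  proof -
    have "\<bar>\<theta> j - 1 / of_int L\<bar> \<le> \<eta>" using \<theta>X[OF that] X(3) by (auto simp: abs_le_iff)
    then have "\<bar>(\<theta> j - 1 / of_int L) * of_int q\<bar> \<le> \<eta> * of_int q"
      unfolding abs_mult using q by (intro mult_mono) auto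
    moreover have "(\<theta> j - 1 / of_int L) * of_int q = \<theta> j * of_int q - of_int r"
      using L by (simp add: q_def left_diff_distrib)
    ultimately show ?thesis using a\<theta>[of j] q2 by simp
  qed
  have LR: "L * (int M * r) = int M * q" by (simp add: q_def)
  show thesis
  proof (rule that[of S "int M * r" "block_code q r a"])
    show "finite S" by fact
    have "2 * 1 \<le> int M * r" using M2 r by (intro mult_mono) auto
    then show "2 \<le> int M * r" by simp
    show "0 \<le> block_code q r a p \<and> block_code q r a p < L" for p
    proof -
      define u where "u = (p * a (p div q)) mod q"
      have "0 \<le> u" "u < L * r" using q by (auto simp: u_def q_def)
      then show ?thesis using r unfolding block_code_def u_def[symmetric]
        by (intro int_div_bounds) auto
    qed
    show "int (card {p\<in>{0..<L * (int M * r)}. block_code q r a p = i}) = int M * r" if "0 \<le> i" "i < L" for i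
      unfolding LR by (rule card_block_code_fiber[where L = L]) (use that r L cop q_def in auto)
    show "real (card {p\<in>{0..<L * (int M * r)}. block_code q r a ((p + n) mod (L * (int M * r))) \<noteq> (block_code q r a p + n) mod L})
       \<le> \<epsilon> * of_int (L * (int M * r))" if n: "\<bar>n\<bar> \<le> 2 * L" for n
    proof -
      \<comment> \<open>Short times: every angle is close to \<open>1 / L\<close>, so all blocks are
        good and time \<open>n\<close> advances the symbol by \<open>n\<close>.\<close>
      define E where "E = \<lfloor>4 * of_int L * \<eta> * of_int q\<rfloor>"
      have E0: "0 \<le> E" using L pos q by (simp add: E_def)
      have "int (card {p\<in>{0..<int M * q}. block_code q r a ((p + n) mod (int M * q)) \<noteq> (block_code q r a p + n) mod L})
        \<le> int M * \<bar>n\<bar> + int M * (L * E) + (int M - int (card {0..<int M})) * q"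
      proof (rule card_block_code_shift)
        fix j assume j: "j \<in> {0..<int M}"
        have "\<bar>real_of_int (n * a j - n * r - q * 0)\<bar> = \<bar>of_int n\<bar> * \<bar>of_int (a j - r)\<bar>"
          by (simp add: right_diff_distrib flip: abs_mult)
        also have "\<dots> \<le> of_int (2 * L) * (2 * \<eta> * of_int q)"
          using n ar[OF j] L by (intro mult_mono) auto
        finally have "real_of_int \<bar>n * a j - n * r - q * 0\<bar> \<le> 4 * of_int L * \<eta> * of_int q" by simp
        then show "\<exists>z. \<bar>n * a j - n * r - q * z\<bar> \<le> E" unfolding E_def by (meson le_floor_iff)
      qed (use r L Mpos cop E0 q_def in auto)
      then have "int (card {p\<in>{0..<int M * q}. block_code q r a ((p + n) mod (int M * q)) \<noteq> (block_code q r a p + n) mod L})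
        \<le> int M * \<bar>n\<bar> + int M * (L * E)"
        by simp
      then have "real (card {p\<in>{0..<int M * q}. block_code q r a ((p + n) mod (int M * q)) \<noteq> (block_code q r a p + n) mod L})
        \<le> of_int (int M * \<bar>n\<bar> + int M * (L * E))"
        by linarith
      also have "\<dots> = real M * (of_int \<bar>n\<bar> + of_int L * of_int E)" by (simp add: algebra_simps)
      also have "\<dots> \<le> real M * (\<epsilon> * of_int q)"
      proof (rule mult_left_mono)
        have "of_int L * of_int E \<le> of_int L * (4 * of_int L * \<eta> * of_int q)"
          using L by (intro mult_left_mono) (auto simp: E_def)
        also have "\<dots> = \<epsilon> * of_int q / 2" using L by (simp add: \<eta>_def power2_eq_square)
        finally show "of_int \<bar>n\<bar> + of_int L * of_int E \<le> \<epsilon> * of_int q" using n q1 by linarith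
      qed simp
      finally show ?thesis unfolding LR by (simp add: mult_ac)
    qed
    show "\<bar>n\<bar> \<le> L * (int M * r)" if "n \<in> S" for n
    proof -
      have "1 * q \<le> int M * q" using Mpos q by (intro mult_right_mono) auto
      then show ?thesis using N(2)[OF that] q5 unfolding LR by linarith
    qed
    show "real (card {p\<in>{0..<L * (int M * r)}. block_code q r a ((p + n) mod (L * (int M * r))) \<noteq> block_code q r a p})
       \<le> \<epsilon> * of_int (L * (int M * r))" if n: "n \<in> S" for n
    proof -
      \<comment> \<open>The blocks whose angle is brought close to an integer by \<open>n\<close>;
        as \<open>\<theta>\<close> is injective on block numbers, at most \<open>k\<close> blocks
        are missing.\<close>
      define G where "G = {j\<in>{0..<int M}. \<exists>m::int. \<bar>of_int n * \<theta> j - of_int m\<bar> < \<epsilon>2}"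
      define E where "E = \<lfloor>2 * \<epsilon>2 * of_int q\<rfloor>"
      have E0: "0 \<le> E" using pos q by (simp add: E_def)
      have bc: "block_code q r a p mod L = block_code q r a p" for p
      proof -
        define u where "u = (p * a (p div q)) mod q"
        have "0 \<le> u" "u < L * r" using q by (auto simp: u_def q_def)
        then show ?thesis using r unfolding block_code_def u_def[symmetric]
          using int_div_bounds[of r u L] by (intro mod_pos_pos_trivial) auto
      qed
      have "int M - int (card G) \<le> int k"
      proof -
        have "{0..<int M} - G = {j\<in>{0..<int M}. \<not> (\<exists>m::int. \<bar>of_int n * \<theta> j - of_int m\<bar> < \<epsilon>2)}"
          by (auto simp: G_def)
        also have "card \<dots> \<le> card {x\<in>X. \<not> (\<exists>m::int. \<bar>of_int n * x - of_int m\<bar> < \<epsilon>2)}"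
        proof (rule card_inj_on_le[of \<theta>])
          show "inj_on \<theta> {j \<in> {0..<int M}. \<nexists>m. \<bar>real_of_int n * \<theta> j - real_of_int m\<bar> < \<epsilon>2}"
            (is "inj_on \<theta> ?J")
          proof (rule inj_onI)
            fix x y assume xy: "x \<in> ?J" "y \<in> ?J" "\<theta> x = \<theta> y"
            then have "nat x = nat y"
              using inj_onD[OF bij_betw_imp_inj_on[OF f], of "nat x" "nat y"] by (auto simp: \<theta>_def)
            then show "x = y" using xy by auto
          qed
        qed (use \<theta>X X(1) in auto)
        also have "\<dots> \<le> k" using n S0(3) by (auto simp: S_def few_def)
        finally have "card ({0..<int M} - G) \<le> k" .
        moreover have "card ({0..<int M} - G) = M - card G"
          by (subst card_Diff_subset) (auto simp: G_def intro: finite_subset[OF _ finite_atLeastLessThan_int[of 0 "int M"]])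
        ultimately show ?thesis by linarith
      qed
      then have kG: "(int M - int (card G)) * q \<le> int k * q" using q by (intro mult_right_mono) auto
      have "int (card {p\<in>{0..<int M * q}. block_code q r a ((p + n) mod (int M * q)) \<noteq> (block_code q r a p + 0) mod L})
        \<le> int M * \<bar>n\<bar> + int M * (L * E) + (int M - int (card G)) * q"
      proof (rule card_block_code_shift)
        fix j assume j: "j \<in> G"
        then obtain m :: int where m: "\<bar>of_int n * \<theta> j - of_int m\<bar> < \<epsilon>2" by (auto simp: G_def)
        have "\<bar>of_int n * (of_int (a j) - \<theta> j * of_int q)\<bar> \<le> of_int N * of_int L"
          unfolding abs_mult using N(2)[OF n] a\<theta>[of j] N(1) by (intro mult_mono) auto
        moreover have "\<bar>of_int q * (of_int n * \<theta> j - of_int m)\<bar> \<le> of_int q * \<epsilon>2"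
          unfolding abs_mult using m q by (intro mult_mono) auto
        \<comment> \<open>Splits the drift into the effect of rounding and the distance of
          \<open>n * \<theta> j\<close> from an integer.\<close>
        moreover have "real_of_int (n * a j - 0 * r - q * m) = 
           of_int n * (of_int (a j) - \<theta> j * of_int q) + of_int q * (of_int n * \<theta> j - of_int m)"
          by (simp add: algebra_simps)
        ultimately have "\<bar>real_of_int (n * a j - 0 * r - q * m)\<bar> \<le> of_int N * of_int L + of_int q * \<epsilon>2"
          by linarith
        moreover have "of_int N * of_int L \<le> of_int q * \<epsilon>2" using q3 by (simp add: mult.commute)
        moreover have "2 * \<epsilon>2 * of_int q = 2 * (of_int q * \<epsilon>2)" by simp
        ultimately have "real_of_int \<bar>n * a j - 0 * r - q * m\<bar> \<le> 2 * \<epsilon>2 * of_int q"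
          unfolding of_int_abs by linarith
        then show "\<exists>z. \<bar>n * a j - 0 * r - q * z\<bar> \<le> E" unfolding E_def by (meson le_floor_iff)
      qed (use r L Mpos cop E0 q_def in \<open>auto simp: G_def\<close>)
      then have "int (card {p\<in>{0..<int M * q}. block_code q r a ((p + n) mod (int M * q)) \<noteq> block_code q r a p})
        \<le> int M * \<bar>n\<bar> + int M * (L * E) + int k * q"
        using kG by (simp add: bc)
      then have "real (card {p\<in>{0..<int M * q}. block_code q r a ((p + n) mod (int M * q)) \<noteq> block_code q r a p})
        \<le> of_int (int M * \<bar>n\<bar> + int M * (L * E) + int k * q)"
        by linarith
      also have "\<dots> = real M * (of_int \<bar>n\<bar> + of_int L * of_int E) + real k * of_int q" by (simp add: algebra_simps)
      also have "\<dots> \<le> real M * (\<epsilon> * of_int q / 2) + real M * (\<epsilon> * of_int q / 2)"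
      proof (rule add_mono[OF mult_left_mono])
        have "of_int L * of_int E \<le> of_int L * (2 * \<epsilon>2 * of_int q)"
          using L by (intro mult_left_mono) (auto simp: E_def)
        also have "\<dots> = \<epsilon> * of_int q / 4" using L by (simp add: \<epsilon>2_def)
        finally show "of_int \<bar>n\<bar> + of_int L * of_int E \<le> \<epsilon> * of_int q / 2" using N(2)[OF n] q4 by linarith
        have "4 * real k \<le> real M * \<epsilon>" using M \<epsilon> by (simp add: pos_divide_less_eq)
        then have "real k * of_int q \<le> (real M * \<epsilon> / 2) * of_int q" using q by (intro mult_right_mono) auto
        then show "real k * of_int q \<le> real M * (\<epsilon> * of_int q / 2)" by simp
      qed simp
      finally show ?thesis unfolding LR by (simp add: mult_ac)
    qed
    show "\<exists>n\<in>S. \<forall>i<k. \<exists>m::int. \<bar>of_int (n - n0) * \<alpha> i - of_int m\<bar> < 1 / real k"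
      if "\<bar>n0\<bar> \<le> int k" for n0 and \<alpha> :: "nat \<Rightarrow> real"
    proof -
      have "n0 \<in> {- int k..int k}" using that by auto
      then show ?thesis using S0(2)[of n0 \<alpha>] unfolding near_def S_def by blast
    qed
  qed
qed

section \<open>The limit of a tower of cyclic permutations\<close>

text \<open>Level \<open>m\<close> is \<open>\<int>/L m\<close> with the map \<open>p \<mapsto> p + 1\<close>, and \<open>\<phi> m\<close> is
  an equidistributed, almost equivariant map from level \<open>m + 1\<close> to level \<open>m\<close>.\<close>

locale cyclic_tower =
  fixes L R :: "nat \<Rightarrow> int" and \<phi> :: "nat \<Rightarrow> int \<Rightarrow> int"
  assumes L_0: "L 0 = 2"
    and L_Suc: "L (Suc m) = L m * R m"
    and R_ge2: "2 \<le> R m"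
    and \<phi>_range: "0 \<le> \<phi> m p \<and> \<phi> m p < L m"
    and \<phi>_fiber: "0 \<le> i \<Longrightarrow> i < L m \<Longrightarrow> int (card {p\<in>{0..<L (Suc m)}. \<phi> m p = i}) = R m"
    and \<phi>_shift: "\<bar>n\<bar> \<le> 2 * L m \<Longrightarrow>
      real (card {p\<in>{0..<L (Suc m)}. \<phi> m ((p + n) mod L (Suc m)) \<noteq> (\<phi> m p + n) mod L m})
        \<le> (1/2) ^ Suc m * of_int (L (Suc m))"
begin

lemma L_ge_power: "2 ^ Suc m \<le> L m"
proof (induction m)
  case (Suc m)
  have "2 ^ Suc m * 2 \<le> L m * R m"
    using Suc R_ge2[of m] by (intro mult_mono) (auto intro: order_trans[of 0 "2 ^ Suc m"])
  then show ?case by (simp add: L_Suc mult.commute)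
qed (simp add: L_0)

lemma L_pos: "0 < L m"
  by (rule less_le_trans[OF _ L_ge_power]) simp

lemma L_mono: "m \<le> m' \<Longrightarrow> L m \<le> L m'"
proof (induction m' rule: dec_induct)
  case (step m')
  have "L m' * 1 \<le> L m' * R m'"
    using L_pos[of m'] R_ge2[of m'] by (intro mult_left_mono) auto
  then show ?case using step by (simp add: L_Suc)
qed simp

lemma L_exceeds: "eventually (\<lambda>m. x \<le> L m) sequentially"
proof -
  have "x \<le> L m" if "nat x \<le> m" for m
  proof -
    have "int m < 2 ^ m" by (metis less_exp of_nat_less_iff of_nat_numeral of_nat_power)
    also have "\<dots> \<le> 2 ^ Suc m" by simp
    also have "\<dots> \<le> L m" by (rule L_ge_power)
    finally show ?thesis using that by linarith
  qed
  then show ?thesis by (auto simp: eventually_sequentially)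
qed

text \<open>All fibres of \<open>\<phi> m\<close> have \<open>R m\<close> elements, so numbering
  each of them by the remainders modulo \<open>R m\<close> lifts a numbering of level
  \<open>m\<close> to level \<open>m + 1\<close>. In these coordinates the maps are integer
  division, so the levels can be realised by nested partitions of an interval.\<close>

lemma ex_coherent_coordinates:
  obtains \<pi> where "\<And>m. bij_betw (\<pi> m) {0..<L m} {0..<L m}"
    "\<And>m i. i \<in> {0..<L (Suc m)} \<Longrightarrow> \<phi> m (\<pi> (Suc m) i) = \<pi> m (i div R m)"
proof -
  define F where "F m v = {p\<in>{0..<L (Suc m)}. \<phi> m p = v}" for m v
  have finF: "finite (F m v)" for m v
    unfolding F_def by (rule finite_subset[OF _ finite_atLeastLessThan_int[of 0 "L (Suc m)"]]) auto
  have ex: "\<exists>e. bij_betw e {0..<R m} (F m v)" if "v \<in> {0..<L m}" for m v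
  proof (rule finite_same_card_bij)
    have "int (card (F m v)) = R m" using \<phi>_fiber[of v m] that by (simp add: F_def)
    then show "card {0..<R m} = card (F m v)" by simp
  qed (use finF in auto)
  obtain e where e: "\<And>m v. v \<in> {0..<L m} \<Longrightarrow> bij_betw (e m v) {0..<R m} (F m v)"
  proof -
    fix thesis
    assume *: "\<And>e. (\<And>m v. v \<in> {0..<L m} \<Longrightarrow> bij_betw (e m v) {0..<R m} (F m v)) \<Longrightarrow> thesis"
    show thesis
      by (rule *[of "\<lambda>m v. SOME e. bij_betw e {0..<R m} (F m v)"]) (rule someI_ex[OF ex])
  qed
  define \<pi> where "\<pi> = rec_nat id (\<lambda>m f i. e m (f (i div R m)) (i mod R m))"
  have \<pi>S: "\<pi> (Suc m) i = e m (\<pi> m (i div R m)) (i mod R m)" for m i by (simp add: \<pi>_def)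
  have Rpos: "0 < R m" for m using R_ge2[of m] by linarith
  have idiv: "i div R m \<in> {0..<L m}" if "i \<in> {0..<L (Suc m)}" for i m
    using int_div_bounds[OF Rpos[of m], of i "L m"] that by (auto simp: L_Suc)
  have bij: "bij_betw (\<pi> m) {0..<L m} {0..<L m}" for m
  proof (induction m)
    case 0
    then show ?case by (simp add: \<pi>_def bij_betw_def inj_on_def)
  next
    case (Suc m)
    have val: "\<pi> (Suc m) i \<in> F m (\<pi> m (i div R m))" if "i \<in> {0..<L (Suc m)}" for i
    proof -
      have "\<pi> m (i div R m) \<in> {0..<L m}" using Suc idiv[OF that] by (auto simp: bij_betw_def)
      then have "e m (\<pi> m (i div R m)) ` {0..<R m} = F m (\<pi> m (i div R m))"
        using e by (simp add: bij_betw_def)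
      then show ?thesis unfolding \<pi>S using Rpos[of m] by (auto intro!: imageI)
    qed
    have inj: "inj_on (\<pi> (Suc m)) {0..<L (Suc m)}"
    proof (rule inj_onI)
      fix i j assume ij: "i \<in> {0..<L (Suc m)}" "j \<in> {0..<L (Suc m)}" "\<pi> (Suc m) i = \<pi> (Suc m) j"
      have "\<pi> m (i div R m) = \<pi> m (j div R m)"
        using val[OF ij(1)] val[OF ij(2)] ij(3) by (simp add: F_def)
      then have d: "i div R m = j div R m"
        using Suc idiv[OF ij(1)] idiv[OF ij(2)] by (auto simp: bij_betw_def inj_on_def)
      have "\<pi> m (i div R m) \<in> {0..<L m}" using Suc idiv[OF ij(1)] by (auto simp: bij_betw_def)
      then have "inj_on (e m (\<pi> m (i div R m))) {0..<R m}" using e by (simp add: bij_betw_def)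
      then have "i mod R m = j mod R m"
        using ij(3) Rpos[of m] unfolding \<pi>S d by (auto simp: inj_on_def)
      then show "i = j" using d by (metis div_mult_mod_eq)
    qed
    have "\<pi> (Suc m) ` {0..<L (Suc m)} \<subseteq> {0..<L (Suc m)}" using val by (auto simp: F_def)
    then show ?case using inj by (simp add: bij_betw_def endo_inj_surj)
  qed
  show thesis
  proof (rule that[OF bij])
    fix m i assume i: "i \<in> {0..<L (Suc m)}"
    have "\<pi> m (i div R m) \<in> {0..<L m}" using bij[of m] idiv[OF i] by (auto simp: bij_betw_def)
    then have "e m (\<pi> m (i div R m)) ` {0..<R m} = F m (\<pi> m (i div R m))"
      using e by (simp add: bij_betw_def)
    then have "\<pi> (Suc m) i \<in> F m (\<pi> m (i div R m))"
      unfolding \<pi>S using Rpos[of m] by (auto intro!: imageI)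
    then show "\<phi> m (\<pi> (Suc m) i) = \<pi> m (i div R m)" by (simp add: F_def)
  qed
qed

end

text \<open>A random point of the inverse limit of the levels, with \<open>p m \<omega>\<close> as
  its position at level \<open>m\<close>.\<close>

locale coded_tower = cyclic_tower + prob_space P
  for P :: "real measure" +
  fixes p :: "nat \<Rightarrow> real \<Rightarrow> int"
  assumes p_measurable [measurable]: "\<And>m. p m \<in> measurable P (count_space UNIV)"
    and p_range: "\<And>m \<omega>. \<omega> \<in> space P \<Longrightarrow> 0 \<le> p m \<omega> \<and> p m \<omega> < L m"
    and p_coherent: "\<And>m \<omega>. \<omega> \<in> space P \<Longrightarrow> \<phi> m (p (Suc m) \<omega>) = p m \<omega>"
    and p_uniform: "\<And>m i. 0 \<le> i \<Longrightarrow> i < L m \<Longrightarrow> prob {\<omega>\<in>space P. p m \<omega> = i} = 1 / of_int (L m)"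

text \<open>The point is uniform in the unit interval, which level \<open>m\<close> cuts into
  \<open>L m\<close> equal pieces labelled through \<open>\<pi> m\<close>. The next level cuts each
  piece into \<open>R m\<close>, so passing back is integer division by \<open>R m\<close>; hence
  coherence.\<close>

lemma (in cyclic_tower) ex_coded_tower: "\<exists>P p. coded_tower L R \<phi> P p"
proof -
  obtain \<pi> where \<pi>: "\<And>m. bij_betw (\<pi> m) {0..<L m} {0..<L m}"
    "\<And>m i. i \<in> {0..<L (Suc m)} \<Longrightarrow> \<phi> m (\<pi> (Suc m) i) = \<pi> m (i div R m)"
    using ex_coherent_coordinates by metis
  define P where "P = restrict_space lborel {0..<1::real}"
  define p where "p m \<omega> = \<pi> m \<lfloor>of_int (L m) * \<omega>\<rfloor>" for m and \<omega> :: real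
  have spP: "space P = {0..<1}" by (simp add: P_def space_restrict_space)
  have fl: "\<lfloor>of_int (L m) * \<omega>\<rfloor> \<in> {0..<L m}" if "\<omega> \<in> {0..<1}" for m \<omega>
  proof -
    have "of_int (L m) * \<omega> < of_int (L m) * 1" using that L_pos[of m] by (intro mult_strict_left_mono) auto
    then show ?thesis using that L_pos[of m] by (auto simp: floor_less_iff)
  qed
  interpret prob_space P
  proof
    show "emeasure P (space P) = 1" unfolding spP
      by (simp add: P_def emeasure_restrict_space)
  qed
  have "coded_tower L R \<phi> P p"
  proof
    show "p m \<in> measurable P (count_space UNIV)" for m
    proof -
      have "(\<lambda>\<omega>::real. \<lfloor>of_int (L m) * \<omega>\<rfloor>) \<in> measurable P (count_space UNIV)"
        unfolding P_def by (intro measurable_restrict_space1) measurable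
      then show ?thesis unfolding p_def by (rule measurable_compose) simp
    qed
    show "0 \<le> p m \<omega> \<and> p m \<omega> < L m" if "\<omega> \<in> space P" for m \<omega>
      using fl[of \<omega> m] that \<pi>(1)[of m] by (auto simp: p_def spP bij_betw_def)
    show "\<phi> m (p (Suc m) \<omega>) = p m \<omega>" if "\<omega> \<in> space P" for m \<omega>
    proof -
      have R: "0 < R m" using R_ge2[of m] by linarith
      have "\<lfloor>of_int (L (Suc m)) * \<omega>\<rfloor> div R m = \<lfloor>of_int (L (Suc m)) * \<omega> / of_int (R m)\<rfloor>"
        using R by (simp add: floor_divide_real_eq_div)
      also have "of_int (L (Suc m)) * \<omega> / of_int (R m) = of_int (L m) * \<omega>"
        using R by (simp add: L_Suc)
      finally show ?thesis unfolding p_def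
        using \<pi>(2)[OF fl[of \<omega> "Suc m"]] that by (simp add: spP)
    qed
    show "measure P {\<omega>\<in>space P. p m \<omega> = i} = 1 / of_int (L m)" if i: "0 \<le> i" "i < L m" for m i
    proof -
      have Lp: "0 < real_of_int (L m)" using L_pos[of m] by simp
      have "i \<in> \<pi> m ` {0..<L m}" using \<pi>(1)[of m] i by (simp add: bij_betw_def)
      then obtain j where j: "j \<in> {0..<L m}" "\<pi> m j = i" by auto
      have A: "p m \<omega> = i \<longleftrightarrow> \<lfloor>of_int (L m) * \<omega>\<rfloor> = j" if "\<omega> \<in> {0..<1}" for \<omega>
        using inj_on_eq_iff[OF bij_betw_imp_inj_on[OF \<pi>(1)] fl[OF that] j(1)] j(2) by (simp add: p_def)
      have B: "\<lfloor>of_int (L m) * \<omega>\<rfloor> = j \<longleftrightarrow> \<omega> \<in> {of_int j / of_int (L m)..<(of_int j + 1) / of_int (L m)}" for \<omega> :: real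
        using Lp by (auto simp: floor_eq_iff field_simps)
      have C: "{of_int j / of_int (L m)..<(of_int j + 1) / of_int (L m)} \<subseteq> {0..<1::real}"
      proof -
        have "j + 1 \<le> L m" using j by simp
        then have "real_of_int (j + 1) \<le> real_of_int (L m)" by (simp only: of_int_le_iff)
        then have "of_int j + 1 \<le> real_of_int (L m)" by simp
        then have "(of_int j + 1) / real_of_int (L m) \<le> 1" using Lp by simp
        moreover have "0 \<le> of_int j / real_of_int (L m)" using j Lp by simp
        ultimately show ?thesis by auto
      qed
      have "{\<omega>\<in>space P. p m \<omega> = i} = {of_int j / of_int (L m)..<(of_int j + 1) / of_int (L m)}"
      proof (intro set_eqI iffI)
        fix \<omega> assume "\<omega> \<in> {\<omega>\<in>space P. p m \<omega> = i}"
        then have "\<omega> \<in> {0..<1}" "p m \<omega> = i" by (simp_all add: spP)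
        then show "\<omega> \<in> {of_int j / of_int (L m)..<(of_int j + 1) / of_int (L m)}" using A B by blast
      next
        fix \<omega> :: real assume *: "\<omega> \<in> {of_int j / of_int (L m)..<(of_int j + 1) / of_int (L m)}"
        then have "\<omega> \<in> {0..<1}" using C by blast
        moreover from this have "p m \<omega> = i" using A B * by blast
        ultimately show "\<omega> \<in> {\<omega>\<in>space P. p m \<omega> = i}" by (simp add: spP)
      qed
      then show ?thesis using Lp C
        by (simp add: P_def measure_restrict_space measure_lborel_Ico divide_right_mono diff_divide_distrib[symmetric])
    qed
  qed
  then show ?thesis by blast
qed

section \<open>Periodic patterns and their limit sequence\<close>

context coded_tower
begin

lemma prob_coordinate:
  "prob {\<omega>\<in>space P. Q (p m \<omega>)} = card {i\<in>{0..<L m}. Q i} / of_int (L m)"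
proof -
  have fin: "finite {i\<in>{0..<L m}. Q i}"
    by (rule finite_subset[OF _ finite_atLeastLessThan_int[of 0 "L m"]]) auto
  have "{\<omega>\<in>space P. Q (p m \<omega>)} = (\<Union>i\<in>{i\<in>{0..<L m}. Q i}. {\<omega>\<in>space P. p m \<omega> = i})"
    using p_range by auto
  also have "prob \<dots> = (\<Sum>i\<in>{i\<in>{0..<L m}. Q i}. prob {\<omega>\<in>space P. p m \<omega> = i})"
    using fin by (intro finite_measure_finite_Union) (auto simp: disjoint_family_on_def)
  also have "\<dots> = (\<Sum>i\<in>{i\<in>{0..<L m}. Q i}. 1 / of_int (L m))"
    by (intro sum.cong) (auto simp: p_uniform)
  finally show ?thesis by simp
qed

text \<open>Projects a position down to level 0, which has two points, and reads off one
  bit.\<close>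

primrec word :: "nat \<Rightarrow> int \<Rightarrow> bool" where
  "word 0 i = (i = 1)"
| "word (Suc m) i = word m (\<phi> m i)"

definition pattern :: "nat \<Rightarrow> int \<Rightarrow> int \<Rightarrow> bool" where
  "pattern m v n = word m ((v + n) mod L m)"

text \<open>The pointwise limit of the patterns. Reading it as "true from some level on" gives a
  measurable value also where the patterns do not settle.\<close>

definition itinerary :: "real \<Rightarrow> int \<Rightarrow> bool" where
  "itinerary \<omega> n = (\<exists>k. \<forall>m\<ge>k. pattern m (p m \<omega>) n)"

lemma pattern_shift: "pattern m v (n + k) = pattern m (v + k) n"
  by (simp add: pattern_def add_ac)

lemma pattern_mod: "pattern m (v mod L m) = pattern m v"
  by (simp add: pattern_def fun_eq_iff mod_add_left_eq)

lemma pattern_measurable [measurable]: "Measurable.pred P (\<lambda>\<omega>. Q (pattern m (p m \<omega>)))"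
  by (rule measurable_compose[OF p_measurable]) simp

lemma itinerary_coordinate_measurable [measurable]: "Measurable.pred P (\<lambda>\<omega>. itinerary \<omega> n)"
proof -
  have "Measurable.pred P (\<lambda>\<omega>. pattern m (p m \<omega>) n)" for m
    using pattern_measurable[of "\<lambda>x. x n"] .
  then show ?thesis unfolding itinerary_def by measurable
qed

lemma itinerary_measurable [measurable]: "itinerary \<in> measurable P (PiM UNIV (\<lambda>_::int. count_space (UNIV::bool set)))"
  by (rule measurable_abs_UNIV) measurable

text \<open>\<open>word (Suc m)\<close> factors through \<open>\<phi> m\<close>, so the two patterns
  can differ at \<open>n\<close> only where \<open>\<phi> m\<close> fails to commute with
  translation by \<open>n\<close>; \<open>\<phi>_shift\<close> bounds that set.\<close>

lemma prob_pattern_step: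
  assumes "\<bar>n\<bar> \<le> 2 * L m"
  shows "prob {\<omega>\<in>space P. pattern m (p m \<omega>) n \<noteq> pattern (Suc m) (p (Suc m) \<omega>) n} \<le> (1/2) ^ Suc m"
proof -
  have "prob {\<omega>\<in>space P. pattern m (p m \<omega>) n \<noteq> pattern (Suc m) (p (Suc m) \<omega>) n}
    \<le> prob {\<omega>\<in>space P. \<phi> m ((p (Suc m) \<omega> + n) mod L (Suc m)) \<noteq> (\<phi> m (p (Suc m) \<omega>) + n) mod L m}"
    by (rule finite_measure_mono) (auto simp: pattern_def p_coherent)
  also have "\<dots> = card {i\<in>{0..<L (Suc m)}. \<phi> m ((i + n) mod L (Suc m)) \<noteq> (\<phi> m i + n) mod L m} / of_int (L (Suc m))"
    by (rule prob_coordinate)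
  also have "\<dots> \<le> (1/2) ^ Suc m"
    using \<phi>_shift[OF assms] L_pos[of "Suc m"] by (simp add: pos_divide_le_eq)
  finally show ?thesis .
qed

text \<open>Union bound over all later levels: the step errors \<open>(1/2) ^ Suc (m + i)\<close>
  sum to \<open>(1/2) ^ m\<close>, and outside their union the patterns are constant at
  \<open>n\<close> from level \<open>m\<close> on. The step bound stays applicable because
  \<open>L\<close> is monotone.\<close>

lemma prob_itinerary_pattern:
  assumes "\<bar>n\<bar> \<le> 2 * L m"
  shows "prob {\<omega>\<in>space P. itinerary \<omega> n \<noteq> pattern m (p m \<omega>) n} \<le> (1/2) ^ m"
proof -
  define A where "A i = {\<omega>\<in>space P. pattern (m + i) (p (m + i) \<omega>) n \<noteq> pattern (Suc (m + i)) (p (Suc (m + i)) \<omega>) n}" for i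
  have [measurable]: "Measurable.pred P (\<lambda>\<omega>. pattern m (p m \<omega>) n)" for m
    using pattern_measurable[of "\<lambda>x. x n"] .
  have Ameas: "A i \<in> events" for i unfolding A_def by measurable
  have Ale: "prob (A i) \<le> (1/2) ^ Suc (m + i)" for i
  proof -
    have "L m \<le> L (m + i)" by (rule L_mono) simp
    then show ?thesis unfolding A_def using assms by (intro prob_pattern_step) linarith
  qed
  have geo: "(\<lambda>i. (1/2::real) ^ Suc (m + i)) sums (1/2) ^ m"
  proof -
    have "(\<lambda>i. (1/2) ^ Suc m * (1/2::real) ^ i) sums ((1/2) ^ Suc m * (1 / (1 - 1/2)))"
      by (intro sums_mult geometric_sums) simp
    then show ?thesis by (simp add: power_add)
  qed
  have sumA: "summable (\<lambda>i. prob (A i))"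
    by (rule summable_comparison_test'[OF sums_summable[OF geo], of 0]) (use Ale in auto)
  have sub: "{\<omega>\<in>space P. itinerary \<omega> n \<noteq> pattern m (p m \<omega>) n} \<subseteq> (\<Union>i. A i)"
  proof (rule subsetI, rule ccontr)
    fix \<omega> assume \<omega>: "\<omega> \<in> {\<omega>\<in>space P. itinerary \<omega> n \<noteq> pattern m (p m \<omega>) n}" "\<omega> \<notin> (\<Union>i. A i)"
    have "pattern (m + i) (p (m + i) \<omega>) n = pattern m (p m \<omega>) n" for i
    proof (induction i)
      case (Suc i)
      then show ?case using \<omega> by (auto simp: A_def)
    qed simp
    then have eq: "pattern m' (p m' \<omega>) n = pattern m (p m \<omega>) n" if "m \<le> m'" for m'
      using that le_Suc_ex by blast
    have "itinerary \<omega> n = pattern m (p m \<omega>) n"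
      unfolding itinerary_def
    proof
      assume "\<exists>k. \<forall>m'\<ge>k. pattern m' (p m' \<omega>) n"
      then obtain k where "\<forall>m'\<ge>k. pattern m' (p m' \<omega>) n" by blast
      then have "pattern (max k m) (p (max k m) \<omega>) n" by simp
      then show "pattern m (p m \<omega>) n" using eq[of "max k m"] by simp
    qed (use eq in blast)
    then show False using \<omega> by simp
  qed
  have "prob {\<omega>\<in>space P. itinerary \<omega> n \<noteq> pattern m (p m \<omega>) n} \<le> prob (\<Union>i. A i)"
    using sub Ameas by (intro finite_measure_mono) auto
  also have "\<dots> \<le> (\<Sum>i. prob (A i))"
    using Ameas sumA by (intro finite_measure_subadditive_countably) auto
  also have "\<dots> \<le> (\<Sum>i. (1/2) ^ Suc (m + i))"
    by (rule suminf_le[OF Ale sumA sums_summable[OF geo]])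
  also have "\<dots> = (1/2) ^ m" using geo by (simp add: sums_iff)
  finally show ?thesis .
qed

end

section \<open>The shift on binary sequences, and cylinder sets\<close>

definition shift :: "int \<Rightarrow> (int \<Rightarrow> 'a) \<Rightarrow> int \<Rightarrow> 'a" where
  "shift n x = (\<lambda>i. x (i + n))"

lemma shift_shift: "shift m (shift n x) = shift (m + n) x"
  by (simp add: shift_def add_ac)

lemma shift_0 [simp]: "shift 0 x = x"
  by (simp add: shift_def)

abbreviation binary_sequences :: "(int \<Rightarrow> bool) measure" where
  "binary_sequences \<equiv> PiM UNIV (\<lambda>_. count_space UNIV)"

lemma space_binary_sequences [simp]: "space binary_sequences = UNIV"
  by (simp add: space_PiM)

lemma shift_measurable [measurable]: "shift n \<in> measurable binary_sequences binary_sequences"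
  unfolding shift_def by (rule measurable_abs_UNIV) (rule measurable_component_singleton, simp)

definition cylinder :: "int set \<Rightarrow> (int \<Rightarrow> 'a) set \<Rightarrow> bool" where
  "cylinder J C \<longleftrightarrow> (\<forall>x y. (\<forall>i\<in>J. x i = y i) \<longrightarrow> (x \<in> C \<longleftrightarrow> y \<in> C))"

lemma cylinderD: "cylinder J C \<Longrightarrow> (\<And>i. i \<in> J \<Longrightarrow> x i = y i) \<Longrightarrow> x \<in> C \<longleftrightarrow> y \<in> C"
  unfolding cylinder_def by blast

lemma cylinder_shift: "cylinder J C \<Longrightarrow> cylinder ((\<lambda>i. i + n) ` J) (shift n -` C)"
  unfolding cylinder_def[of "(\<lambda>i. i + n) ` J"] vimage_eq
  by (intro allI impI cylinderD[of J C]) (auto simp: shift_def)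

text \<open>Product sets over finite index sets are cylinders, and they determine a finite measure
  on the product.\<close>

lemma measure_eqI_cylinders:
  assumes "sets M1 = sets binary_sequences" "sets M2 = sets binary_sequences" "finite_measure M1"
    "finite_measure M2"
    and eq: "\<And>J C. finite J \<Longrightarrow> cylinder J C \<Longrightarrow> C \<in> sets binary_sequences \<Longrightarrow> measure M1 C = measure M2 C"
  shows "M1 = M2"
proof (rule measure_eqI_PiM_infinite[OF assms(1,2) _ assms(3)])
  interpret M1: finite_measure M1 by fact
  interpret M2: finite_measure M2 by fact
  fix A :: "int \<Rightarrow> bool set" and J :: "int set"
  assume J: "finite J"
  define C where "C = prod_emb UNIV (\<lambda>_::int. count_space (UNIV::bool set)) J (Pi\<^sub>E J A)"
  have "C \<in> sets binary_sequences"
    unfolding C_def using J by (intro measurable_prod_emb) auto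
  moreover have "cylinder J C"
    unfolding cylinder_def C_def by (auto simp: prod_emb_iff PiE_iff extensional_def)
  ultimately have "measure M1 C = measure M2 C" using eq J by blast
  then show "emeasure M1 (prod_emb UNIV (\<lambda>_::int. count_space (UNIV::bool set)) J (Pi\<^sub>E J A)) =
      emeasure M2 (prod_emb UNIV (\<lambda>_::int. count_space (UNIV::bool set)) J (Pi\<^sub>E J A))"
    by (simp add: M1.emeasure_eq_measure M2.emeasure_eq_measure C_def)
qed

lemma eq_if_close_powers:
  fixes a b c :: real
  assumes "eventually (\<lambda>m. \<bar>a - b\<bar> \<le> c * (1/2) ^ m) sequentially"
  shows "a = b"
proof -
  have "(\<lambda>m. c * (1/2::real) ^ m) \<longlonglongrightarrow> c * 0"
    by (intro tendsto_intros LIMSEQ_realpow_zero) auto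
  then have "\<bar>a - b\<bar> \<le> c * 0"
    by (rule tendsto_lowerbound) (use assms in auto)
  then show ?thesis by simp
qed

section \<open>The law of the limit sequence: invariance, ergodicity and rigidity\<close>

context coded_tower
begin

definition itinerary_law :: "(int \<Rightarrow> bool) measure" where
  "itinerary_law = distr P binary_sequences itinerary"

lemma sets_itinerary_law [simp]: "sets itinerary_law = sets binary_sequences"
  and space_itinerary_law [simp]: "space itinerary_law = UNIV"
  by (simp_all add: itinerary_law_def)

lemma prob_space_itinerary_law: "prob_space itinerary_law"
  unfolding itinerary_law_def by (rule prob_space_distr) measurable

lemma measure_itinerary_law: "C \<in> sets binary_sequences \<Longrightarrow> measure itinerary_law C = prob {\<omega>\<in>space P. itinerary \<omega> \<in> C}"
  unfolding itinerary_law_def by (subst measure_distr) (auto intro!: arg_cong[where f = prob])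

lemma itinerary_in_sets [measurable]: "C \<in> sets binary_sequences \<Longrightarrow> {\<omega>\<in>space P. itinerary \<omega> \<in> C} \<in> events"
  using measurable_sets[OF itinerary_measurable, of C] by (simp add: vimage_def Int_def conj_commute)

lemma pattern_in_sets [measurable]: "{\<omega>\<in>space P. pattern m (p m \<omega>) \<in> C} \<in> events"
  using pattern_measurable[of "\<lambda>x. x \<in> C" m] by simp

text \<open>A cylinder over \<open>J\<close> cannot tell the limit sequence from the pattern where
  both agree on \<open>J\<close>, and a union bound over \<open>J\<close> controls the rest. The
  intersection with \<open>E\<close> serves the ergodicity proof, where \<open>E\<close> comes from
  an invariant set.\<close>

lemma prob_cylinder_approx:
  assumes "finite J" "cylinder J C" "C \<in> sets binary_sequences" "E \<in> events"
    and J: "\<And>i. i \<in> J \<Longrightarrow> \<bar>i\<bar> \<le> 2 * L m"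
  shows "\<bar>prob (E \<inter> {\<omega>\<in>space P. itinerary \<omega> \<in> C}) - prob (E \<inter> {\<omega>\<in>space P. pattern m (p m \<omega>) \<in> C})\<bar>
    \<le> real (card J) * (1/2) ^ m"
proof -
  define D where "D i = {\<omega>\<in>space P. itinerary \<omega> i \<noteq> pattern m (p m \<omega>) i}" for i
  have [measurable]: "Measurable.pred P (\<lambda>\<omega>. pattern m (p m \<omega>) n)" for m n
    using pattern_measurable[of "\<lambda>x. x n"] .
  have D: "D i \<in> events" for i unfolding D_def by measurable
  have "prob (\<Union>i\<in>J. D i) \<le> (\<Sum>i\<in>J. prob (D i))"
    using D \<open>finite J\<close> by (intro finite_measure_subadditive_finite) auto
  also have "\<dots> \<le> (\<Sum>i\<in>J. (1/2) ^ m)"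
    unfolding D_def by (intro sum_mono prob_itinerary_pattern J)
  finally have DJ: "prob (\<Union>i\<in>J. D i) \<le> real (card J) * (1/2) ^ m" by simp
  have DU: "(\<Union>i\<in>J. D i) \<in> events" using D \<open>finite J\<close> by auto
  have close: "prob A \<le> prob B + prob (\<Union>i\<in>J. D i)"
    if "A \<subseteq> B \<union> (\<Union>i\<in>J. D i)" "A \<in> events" "B \<in> events" for A B
  proof -
    have "prob A \<le> prob (B \<union> (\<Union>i\<in>J. D i))" using that DU by (intro finite_measure_mono) auto
    also have "\<dots> \<le> prob B + prob (\<Union>i\<in>J. D i)" using that DU by (intro measure_Un_le) auto
    finally show ?thesis .
  qed
  have agree: "itinerary \<omega> \<in> C \<longleftrightarrow> pattern m (p m \<omega>) \<in> C" if "\<omega> \<in> space P" "\<omega> \<notin> (\<Union>i\<in>J. D i)" for \<omega>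
    by (rule cylinderD[OF assms(2)]) (use that in \<open>auto simp: D_def\<close>)
  have ev: "E \<inter> {\<omega>\<in>space P. itinerary \<omega> \<in> C} \<in> events" "E \<inter> {\<omega>\<in>space P. pattern m (p m \<omega>) \<in> C} \<in> events"
    using assms itinerary_in_sets pattern_in_sets by (intro sets.Int; simp)+
  have "prob (E \<inter> {\<omega>\<in>space P. itinerary \<omega> \<in> C}) \<le> prob (E \<inter> {\<omega>\<in>space P. pattern m (p m \<omega>) \<in> C}) + prob (\<Union>i\<in>J. D i)"
    using agree by (intro close ev) blast
  moreover have "prob (E \<inter> {\<omega>\<in>space P. pattern m (p m \<omega>) \<in> C}) \<le> prob (E \<inter> {\<omega>\<in>space P. itinerary \<omega> \<in> C}) + prob (\<Union>i\<in>J. D i)"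
    using agree by (intro close ev) blast
  ultimately show ?thesis using DJ by linarith
qed

lemma measure_cylinder_approx:
  assumes "finite J" "cylinder J C" "C \<in> sets binary_sequences" "\<And>i. i \<in> J \<Longrightarrow> \<bar>i\<bar> \<le> 2 * L m"
  shows "\<bar>measure itinerary_law C - prob {\<omega>\<in>space P. pattern m (p m \<omega>) \<in> C}\<bar> \<le> real (card J) * (1/2) ^ m"
  using prob_cylinder_approx[OF assms(1-3) sets.top assms(4)] assms(3)
  by (simp add: measure_itinerary_law Int_absorb1 Collect_conj_eq)

lemma card_cyclic_shift:
  "card {v\<in>{0..<L m}. pattern m (v + n) \<in> C} = card {v\<in>{0..<L m}. pattern m v \<in> C}"
proof -
  have bij: "bij_betw (\<lambda>v. (v + n) mod L m) {0..<L m} {0..<L m}"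
  proof (rule bij_betw_byWitness[where f' = "\<lambda>v. (v - n) mod L m"])
    show "\<forall>a\<in>{0..<L m}. ((a + n) mod L m - n) mod L m = a"
      by (auto simp: mod_diff_left_eq)
    show "\<forall>a\<in>{0..<L m}. ((a - n) mod L m + n) mod L m = a"
      by (auto simp: mod_add_left_eq)
  qed (use L_pos in auto)
  show ?thesis
    by (rule bij_betw_same_card, rule bij_betw_Collect[OF bij]) (simp add: pattern_mod)
qed

lemma eventually_window: "finite J \<Longrightarrow> eventually (\<lambda>m. \<forall>i\<in>J. \<bar>i\<bar> \<le> L m) sequentially"
  by (intro eventually_ball_finite ballI L_exceeds)

lemma shift_pattern: "shift n (pattern m v) = pattern m (v + n)"
  by (simp add: shift_def fun_eq_iff pattern_shift)

text \<open>At level \<open>m\<close> the position is uniform and translation permutes the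
  positions, so the law of the random pattern is exactly shift invariant; on a fixed cylinder, for
  large \<open>m\<close>, it differs from the law of the limit by at most a multiple of
  \<open>(1/2) ^ m\<close>.\<close>

lemma itinerary_law_shift: "distr itinerary_law itinerary_law (shift n) = itinerary_law"
proof (rule measure_eqI_cylinders)
  interpret M: prob_space itinerary_law by (rule prob_space_itinerary_law)
  have meas: "shift n \<in> measurable itinerary_law itinerary_law"
    using shift_measurable[of n] by (simp cong: measurable_cong_sets)
  show "finite_measure itinerary_law" by unfold_locales
  show "finite_measure (distr itinerary_law itinerary_law (shift n))"
    by (rule M.finite_measure_distr[OF meas])
  fix J C assume J: "finite J" "cylinder J C" and C: "C \<in> sets binary_sequences"
  have C': "shift n -` C \<in> sets binary_sequences"
    using measurable_sets[OF shift_measurable C, of n] by simp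
  have J': "finite ((\<lambda>i. i + n) ` J)" "cylinder ((\<lambda>i. i + n) ` J) (shift n -` C)"
    using J cylinder_shift by auto
  have "measure itinerary_law (shift n -` C) = measure itinerary_law C"
  proof (rule eq_if_close_powers)
    show "eventually (\<lambda>m. \<bar>measure itinerary_law (shift n -` C) - measure itinerary_law C\<bar>
        \<le> (real (card ((\<lambda>i. i + n) ` J)) + real (card J)) * (1/2) ^ m) sequentially"
      using eventually_window[OF J(1)] eventually_window[OF J'(1)]
    proof eventually_elim
      case (elim m)
      have "prob {\<omega>\<in>space P. pattern m (p m \<omega>) \<in> shift n -` C} = prob {\<omega>\<in>space P. pattern m (p m \<omega>) \<in> C}"
        unfolding vimage_eq shift_pattern prob_coordinate[of "\<lambda>v. pattern m (v + n) \<in> C"]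
          prob_coordinate[of "\<lambda>v. pattern m v \<in> C"] card_cyclic_shift ..
      moreover have "\<bar>measure itinerary_law (shift n -` C) - prob {\<omega>\<in>space P. pattern m (p m \<omega>) \<in> shift n -` C}\<bar>
          \<le> real (card ((\<lambda>i. i + n) ` J)) * (1/2) ^ m"
        by (rule measure_cylinder_approx[OF J' C']) (use elim in fastforce)
      moreover have "\<bar>measure itinerary_law C - prob {\<omega>\<in>space P. pattern m (p m \<omega>) \<in> C}\<bar> \<le> real (card J) * (1/2) ^ m"
        by (rule measure_cylinder_approx[OF J C]) (use elim in fastforce)
      ultimately show ?case unfolding distrib_right by linarith
    qed
  qed
  then show "measure (distr itinerary_law itinerary_law (shift n)) C = measure itinerary_law C"
    using C meas by (simp add: measure_distr)
qed simp_all

lemma measure_shift_vimage: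
  assumes "C \<in> sets binary_sequences"
  shows "measure itinerary_law (shift n -` C) = measure itinerary_law C"
proof -
  have "measure itinerary_law C = measure (distr itinerary_law itinerary_law (shift n)) C" by (simp add: itinerary_law_shift)
  also have "\<dots> = measure itinerary_law (shift n -` C)"
    using assms shift_measurable[of n] by (subst measure_distr) (simp_all cong: measurable_cong_sets)
  finally show ?thesis ..
qed

text \<open>The source of ergodicity: over a full period, the number of visits to \<open>C\<close> of the \<open>m\<close>-th
  periodic approximation does not depend on the starting point.\<close>

lemma sum_prob_period:
  assumes E: "E \<in> events"
  shows "(\<Sum>n\<in>{0..<L m}. prob (E \<inter> {\<omega>\<in>space P. pattern m (p m \<omega>) \<in> shift n -` C}))
    = prob E * (of_int (L m) * prob {\<omega>\<in>space P. pattern m (p m \<omega>) \<in> C})"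
proof -
  define K where "K = card {v\<in>{0..<L m}. pattern m v \<in> C}"
  define F where "F n = {\<omega>\<in>space P. pattern m (p m \<omega>) \<in> shift n -` C}" for n
  have F: "E \<inter> F n \<in> events" for n unfolding F_def using E pattern_in_sets by (intro sets.Int; simp)
  have "(\<Sum>n\<in>{0..<L m}. prob (E \<inter> F n)) = (\<Sum>n\<in>{0..<L m}. \<integral>\<omega>. indicator (E \<inter> F n) \<omega> \<partial>P)"
    using F by simp
  also have "\<dots> = (\<integral>\<omega>. (\<Sum>n\<in>{0..<L m}. indicator (E \<inter> F n) \<omega>) \<partial>P)"
    using F by (intro Bochner_Integration.integral_sum[symmetric]) (simp add: emeasure_eq_measure)
  also have "\<dots> = (\<integral>\<omega>. real K * indicator E \<omega> \<partial>P)"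
  proof (rule Bochner_Integration.integral_cong)
    fix \<omega> assume \<omega>: "\<omega> \<in> space P"
    have "(\<Sum>n\<in>{0..<L m}. indicator (E \<inter> F n) \<omega> :: real) =
        (\<Sum>n\<in>{0..<L m}. indicator E \<omega> * (if pattern m (n + p m \<omega>) \<in> C then 1 else 0))"
      using \<omega> by (intro sum.cong) (auto simp: F_def indicator_def shift_pattern add.commute)
    also have "\<dots> = indicator E \<omega> * real (card {n\<in>{0..<L m}. pattern m (n + p m \<omega>) \<in> C})"
      by (simp add: sum_distrib_left[symmetric] sum.If_cases Int_def)
    also have "card {n\<in>{0..<L m}. pattern m (n + p m \<omega>) \<in> C} = K"
      unfolding K_def by (rule card_cyclic_shift)
    finally show "(\<Sum>n\<in>{0..<L m}. indicator (E \<inter> F n) \<omega>) = real K * indicator E \<omega>"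
      by (simp only: mult.commute)
  qed simp
  also have "\<dots> = real K * prob E" using E by simp
  also have "real K = of_int (L m) * prob {\<omega>\<in>space P. pattern m (p m \<omega>) \<in> C}"
    using L_pos[of m] by (simp add: prob_coordinate[of "\<lambda>v. pattern m v \<in> C"] K_def)
  finally show ?thesis by (simp add: F_def mult_ac)
qed

text \<open>An invariant \<open>D\<close> is independent of every cylinder \<open>C\<close>:
  \<open>D \<inter> C\<close> has the same measure as the intersection of \<open>D\<close> with any
  translate of \<open>C\<close>. Averaging over the translates by \<open>n\<close> below
  \<open>L m\<close> and replacing limit sequences by patterns gives the product, by
  \<open>sum_prob_period\<close>, up to a multiple of \<open>(1/2) ^ m\<close>. Since cylinders
  determine the measure, conditioning on \<open>D\<close> does not change it, while it gives
  \<open>D\<close> measure 1.\<close>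

lemma itinerary_law_ergodic:
  assumes D: "D \<in> sets binary_sequences" and inv: "shift 1 -` D = D"
  shows "measure itinerary_law D = 0 \<or> measure itinerary_law D = 1"
proof (cases "measure itinerary_law D = 0")
  case False
  interpret M: prob_space itinerary_law by (rule prob_space_itinerary_law)
  have invn: "shift (int n) -` D = D" for n
  proof (induction n)
    case (Suc n)
    have "shift (int (Suc n)) -` D = shift (int n) -` (shift 1 -` D)"
      by (auto simp: shift_shift)
    then show ?case using Suc inv by simp
  qed auto
  define E where "E = {\<omega>\<in>space P. itinerary \<omega> \<in> D}"
  have E: "E \<in> events" and PE: "prob E = measure itinerary_law D"
    unfolding E_def using D measure_itinerary_law by auto
  have indep: "measure itinerary_law (D \<inter> C) = measure itinerary_law D * measure itinerary_law C"
    if J: "finite J" "cylinder J C" and C: "C \<in> sets binary_sequences" for J C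
  proof (rule eq_if_close_powers)
    show "eventually (\<lambda>m. \<bar>measure itinerary_law (D \<inter> C) - measure itinerary_law D * measure itinerary_law C\<bar>
        \<le> (2 * real (card J)) * (1/2) ^ m) sequentially"
      using eventually_window[OF J(1)]
    proof eventually_elim
      case (elim m)
      define \<delta> where "\<delta> = real (card J) * (1/2) ^ m"
      define g where "g = measure itinerary_law (D \<inter> C)"
      define h where "h n = prob (E \<inter> {\<omega>\<in>space P. pattern m (p m \<omega>) \<in> shift n -` C})" for n
      have gh: "\<bar>g - h n\<bar> \<le> \<delta>" if n: "n \<in> {0..<L m}" for n
      proof -
        have C': "shift n -` C \<in> sets binary_sequences"
          using measurable_sets[OF shift_measurable C, of n] by simp
        have "shift n -` D = D" using invn[of "nat n"] n by simp
        then have "shift n -` (D \<inter> C) = D \<inter> shift n -` C" by auto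
        then have "g = measure itinerary_law (D \<inter> shift n -` C)"
          using measure_shift_vimage[of "D \<inter> C" n] D C by (simp add: g_def sets.Int)
        also have "\<dots> = prob (E \<inter> {\<omega>\<in>space P. itinerary \<omega> \<in> shift n -` C})"
          using measure_itinerary_law[of "D \<inter> shift n -` C"] D C'
          by (simp add: sets.Int E_def) (intro arg_cong[where f = prob], auto)
        finally have "g = prob (E \<inter> {\<omega>\<in>space P. itinerary \<omega> \<in> shift n -` C})" .
        moreover have "\<bar>prob (E \<inter> {\<omega>\<in>space P. itinerary \<omega> \<in> shift n -` C}) - h n\<bar>
            \<le> real (card ((\<lambda>i. i + n) ` J)) * (1/2) ^ m"
          unfolding h_def
        proof (rule prob_cylinder_approx[OF _ cylinder_shift[OF J(2)] C' E])
          \<comment> \<open>Translation by \<open>n < L m\<close> takes the window of radius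
            \<open>L m\<close> into radius \<open>2 * L m\<close>; this is why
            \<open>\<phi>_shift\<close> covers twice the period.\<close>
          fix i assume "i \<in> (\<lambda>i. i + n) ` J"
          then obtain j where "j \<in> J" "i = j + n" by blast
          then show "\<bar>i\<bar> \<le> 2 * L m" using elim n by fastforce
        qed (use J in simp)
        moreover have "real (card ((\<lambda>i. i + n) ` J)) * (1/2) ^ m \<le> \<delta>"
          unfolding \<delta>_def using card_image_le[OF J(1)] by (intro mult_right_mono) auto
        ultimately show ?thesis by linarith
      qed
      have Lp: "0 < real_of_int (L m)" using L_pos[of m] by simp
      \<comment> \<open>Summed over a period, the \<open>h n\<close> are known exactly, whereas
        \<open>g\<close> does not depend on \<open>n\<close>.\<close>
      have "of_int (L m) * g - prob E * (of_int (L m) * prob {\<omega>\<in>space P. pattern m (p m \<omega>) \<in> C})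
          = (\<Sum>n\<in>{0..<L m}. g - h n)"
        unfolding h_def sum_subtractf sum_prob_period[OF E] using L_pos[of m] by simp
      also have "\<bar>\<dots>\<bar> \<le> (\<Sum>n\<in>{0..<L m}. \<delta>)"
        by (rule order_trans[OF sum_abs sum_mono]) (rule gh)
      also have "\<dots> = of_int (L m) * \<delta>" using L_pos[of m] by simp
      finally have "\<bar>of_int (L m) * (g - prob E * prob {\<omega>\<in>space P. pattern m (p m \<omega>) \<in> C})\<bar> \<le> of_int (L m) * \<delta>"
        by (simp add: algebra_simps)
      then have 1: "\<bar>g - prob E * prob {\<omega>\<in>space P. pattern m (p m \<omega>) \<in> C}\<bar> \<le> \<delta>"
        using Lp by (simp add: abs_mult)
      have "\<bar>measure itinerary_law C - prob {\<omega>\<in>space P. pattern m (p m \<omega>) \<in> C}\<bar> \<le> \<delta>"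
        unfolding \<delta>_def by (rule measure_cylinder_approx[OF J C]) (use elim in fastforce)
      then have "\<bar>prob E * (measure itinerary_law C - prob {\<omega>\<in>space P. pattern m (p m \<omega>) \<in> C})\<bar> \<le> 1 * \<delta>"
        unfolding abs_mult by (intro mult_mono) auto
      then have 2: "\<bar>prob E * measure itinerary_law C - prob E * prob {\<omega>\<in>space P. pattern m (p m \<omega>) \<in> C}\<bar> \<le> \<delta>"
        by (simp add: right_diff_distrib)
      have "\<bar>g - prob E * measure itinerary_law C\<bar> \<le> 2 * \<delta>" using 1 2 by linarith
      then show ?case by (simp add: PE g_def \<delta>_def)
    qed
  qed
  have pos: "emeasure itinerary_law D \<noteq> 0" "emeasure itinerary_law D \<noteq> \<infinity>"
    using False by (simp_all add: M.emeasure_eq_measure)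
  have "uniform_measure itinerary_law D = itinerary_law"
  proof (rule measure_eqI_cylinders)
    show "finite_measure (uniform_measure itinerary_law D)"
      using prob_space_uniform_measure[OF pos] by (simp add: prob_space_def)
    show "finite_measure itinerary_law" by unfold_locales
    fix J C assume "finite J" "cylinder J C" "C \<in> sets binary_sequences"
    then show "measure (uniform_measure itinerary_law D) C = measure itinerary_law C"
      using indep False pos by (subst measure_uniform_measure) auto
  qed simp_all
  then have "measure itinerary_law D = measure (uniform_measure itinerary_law D) D" by simp
  also have "\<dots> = 1" using pos D False by (subst measure_uniform_measure) auto
  finally show ?thesis by simp
qed simp

text \<open>By coherence the words at the positions of all levels equal the level 0 bit, so
  coordinate 0 of the limit sequence is exactly that bit; it is uniform as
  \<open>L 0 = 2\<close>.\<close>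

lemma itinerary_law_nontrivial: "measure itinerary_law {x. x 0} = 1 / 2"
proof -
  have word: "word m (p m \<omega>) = (p 0 \<omega> = 1)" if "\<omega> \<in> space P" for m \<omega>
    by (induction m) (simp_all add: p_coherent that)
  have "itinerary \<omega> 0 \<longleftrightarrow> p 0 \<omega> = 1" if "\<omega> \<in> space P" for \<omega>
    unfolding itinerary_def pattern_def using p_range[OF that] that by (auto simp: word mod_pos_pos_trivial)
  then have "{\<omega>\<in>space P. itinerary \<omega> \<in> {x. x 0}} = {\<omega>\<in>space P. p 0 \<omega> = 1}" by auto
  moreover have "{x. x 0} \<in> sets binary_sequences"
    using measurable_sets[OF measurable_component_singleton[of 0 UNIV "\<lambda>_::int. count_space (UNIV::bool set)"], of "{True}"]
    by (simp add: vimage_def)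
  ultimately show ?thesis
    using p_uniform[of 1 0] by (simp add: measure_itinerary_law L_0)
qed

text \<open>By stationarity only coordinates 0 and \<open>n\<close> matter. Both are compared with
  the pattern of level \<open>m + 1\<close>, whose symbols at 0 and \<open>n\<close> coincide unless
  \<open>n\<close> moves the position to a different value of \<open>\<phi> m\<close>. Three errors
  of \<open>(1/2) ^ Suc m\<close> stay below the bound.\<close>

lemma itinerary_law_rigid_coordinate:
  assumes n: "\<bar>n\<bar> \<le> L (Suc m)"
    and rig: "real (card {v\<in>{0..<L (Suc m)}. \<phi> m ((v + n) mod L (Suc m)) \<noteq> \<phi> m v}) \<le> (1/2) ^ Suc m * of_int (L (Suc m))"
  shows "measure itinerary_law {x. x i \<noteq> x (i + n)} \<le> 2 * (1/2) ^ m"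
proof -
  have [measurable]: "Measurable.pred P (\<lambda>\<omega>. pattern m (p m \<omega>) n)" for m n
    using pattern_measurable[of "\<lambda>x. x n"] .
  define D where "D j = {\<omega>\<in>space P. itinerary \<omega> j \<noteq> pattern (Suc m) (p (Suc m) \<omega>) j}" for j
  define B where "B = {\<omega>\<in>space P. \<phi> m ((p (Suc m) \<omega> + n) mod L (Suc m)) \<noteq> \<phi> m (p (Suc m) \<omega>)}"
  have D: "D j \<in> events" for j unfolding D_def by measurable
  have B: "B \<in> events" unfolding B_def by measurable
  have set: "{x. x j \<noteq> x k} \<in> sets binary_sequences" for j k :: int
  proof -
    have "Measurable.pred binary_sequences (\<lambda>x. x j \<noteq> x k)" by measurable
    then show ?thesis by (simp add: pred_def)
  qed
  have eq: "{x :: int \<Rightarrow> bool. x i \<noteq> x (i + n)} = shift i -` {x. x 0 \<noteq> x n}" by (auto simp: shift_def add.commute)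
  have "measure itinerary_law {x. x i \<noteq> x (i + n)} = measure itinerary_law {x. x 0 \<noteq> x n}"
    by (simp only: eq measure_shift_vimage[OF set])
  also have "\<dots> = prob {\<omega>\<in>space P. itinerary \<omega> 0 \<noteq> itinerary \<omega> n}" using measure_itinerary_law[OF set] by simp
  also have "\<dots> \<le> prob (B \<union> (D 0 \<union> D n))"
  proof (rule finite_measure_mono)
    show "{\<omega>\<in>space P. itinerary \<omega> 0 \<noteq> itinerary \<omega> n} \<subseteq> B \<union> (D 0 \<union> D n)"
    proof (rule subsetI, rule ccontr)
      fix \<omega> assume \<omega>: "\<omega> \<in> {\<omega>\<in>space P. itinerary \<omega> 0 \<noteq> itinerary \<omega> n}" "\<omega> \<notin> B \<union> (D 0 \<union> D n)"
      have "p (Suc m) \<omega> mod L (Suc m) = p (Suc m) \<omega>"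
        using p_range[of \<omega> "Suc m"] \<omega> by (intro mod_pos_pos_trivial) auto
      then have "pattern (Suc m) (p (Suc m) \<omega>) 0 = pattern (Suc m) (p (Suc m) \<omega>) n"
        using \<omega> by (simp add: B_def pattern_def)
      then show False using \<omega> unfolding D_def by blast
    qed
  qed (use B D in auto)
  also have "\<dots> \<le> prob B + prob (D 0 \<union> D n)" using B D by (intro measure_Un_le) auto
  also have "\<dots> \<le> prob B + (prob (D 0) + prob (D n))" using D by (intro add_left_mono measure_Un_le) auto
  also have "prob B \<le> (1/2) ^ Suc m"
    unfolding B_def prob_coordinate[of "\<lambda>v. \<phi> m ((v + n) mod L (Suc m)) \<noteq> \<phi> m v"]
    using rig L_pos[of "Suc m"] by (simp add: pos_divide_le_eq)
  also have "prob (D 0) \<le> (1/2) ^ Suc m"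
    unfolding D_def by (rule prob_itinerary_pattern) (use L_pos[of "Suc m"] in simp)
  also have "prob (D n) \<le> (1/2) ^ Suc m"
    unfolding D_def by (rule prob_itinerary_pattern) (use n in simp)
  finally have "measure itinerary_law {x. x i \<noteq> x (i + n)} \<le> (1/2) ^ Suc m + ((1/2) ^ Suc m + (1/2) ^ Suc m)"
    by simp
  moreover have "(0::real) \<le> (1/2) ^ Suc m" by simp
  ultimately show ?thesis unfolding power_Suc by linarith
qed

end

lemma sym_diff_UN_subset:
  "((\<Union>k. A k) - (\<Union>k. B k)) \<union> ((\<Union>k. B k) - (\<Union>k. A k)) \<subseteq>
    (\<Union>k<K. (A k - B k) \<union> (B k - A k)) \<union> (((\<Union>k. A k) - (\<Union>k<K. A k)) \<union> ((\<Union>k. B k) - (\<Union>k<K. B k)))"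
  for K :: nat
  by blast

text \<open>The sets that are asymptotically invariant along \<open>S\<close> are closed under
  complements and countable unions, and contain the coordinate sets by
  \<open>itinerary_law_rigid_coordinate\<close>; so induction over the generated sigma-algebra
  applies.\<close>

lemma (in coded_tower) itinerary_law_rigid:
  fixes S :: "nat \<Rightarrow> int set"
  assumes S: "\<And>m n. n \<in> S m \<Longrightarrow> \<bar>n\<bar> \<le> L (Suc m)"
    "\<And>m n. n \<in> S m \<Longrightarrow>
      real (card {v\<in>{0..<L (Suc m)}. \<phi> m ((v + n) mod L (Suc m)) \<noteq> \<phi> m v}) \<le> (1/2) ^ Suc m * of_int (L (Suc m))"
    and D: "D \<in> sets binary_sequences" and "\<epsilon> > 0"
  shows "eventually (\<lambda>m. \<forall>n\<in>S m. measure itinerary_law ((D - shift n -` D) \<union> (shift n -` D - D)) \<le> \<epsilon>) sequentially"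
proof -
  interpret M: prob_space itinerary_law by (rule prob_space_itinerary_law)
  have vm: "shift n -` A \<in> sets binary_sequences" if "A \<in> sets binary_sequences" for n A
    using measurable_sets[OF shift_measurable that, of n] by simp
  have sd: "(A - shift n -` A) \<union> (shift n -` A - A) \<in> sets binary_sequences" if "A \<in> sets binary_sequences" for n A
    using vm[OF that, of n] that by auto
  have gen: "sets binary_sequences = sigma_sets UNIV {{x. x i \<in> A} | (i::int) (A::bool set). True}"
    unfolding sets_PiM_single by (simp add: PiE_UNIV_domain)
  have "D \<in> sigma_sets UNIV {{x. x i \<in> A} | (i::int) (A::bool set). True}" using D gen by simp
  then show ?thesis using \<open>\<epsilon> > 0\<close>
  proof (induction arbitrary: \<epsilon>)
    case (Basic a)
    then obtain i A where a: "a = {x. x i \<in> A}" by blast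
    have "(\<lambda>m. 2 * (1/2::real) ^ m) \<longlonglongrightarrow> 2 * 0"
      by (intro tendsto_intros LIMSEQ_realpow_zero) auto
    then have "eventually (\<lambda>m. 2 * (1/2::real) ^ m < \<epsilon>) sequentially"
      by (rule order_tendstoD) (use Basic in simp)
    then show ?case
    proof eventually_elim
      case (elim m)
      show ?case
      proof
        fix n assume n: "n \<in> S m"
        have "{x. x i \<noteq> x (i + n)} \<in> sets binary_sequences"
        proof -
          have "Measurable.pred binary_sequences (\<lambda>x. x i \<noteq> x (i + n))" by measurable
          then show ?thesis by (simp add: pred_def)
        qed
        moreover have "(a - shift n -` a) \<union> (shift n -` a - a) \<subseteq> {x. x i \<noteq> x (i + n)}"
          unfolding a shift_def by (rule subsetI, rule CollectI, rule notI) simp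
        ultimately have "measure itinerary_law ((a - shift n -` a) \<union> (shift n -` a - a)) \<le> measure itinerary_law {x. x i \<noteq> x (i + n)}"
          by (intro M.finite_measure_mono) simp_all
        also have "\<dots> \<le> 2 * (1/2) ^ m" by (rule itinerary_law_rigid_coordinate[OF S[OF n]])
        finally show "measure itinerary_law ((a - shift n -` a) \<union> (shift n -` a - a)) \<le> \<epsilon>" using elim by simp
      qed
    qed
  next
    case Empty
    then show ?case by simp
  next
    case (Compl a)
    have "((UNIV - a) - shift n -` (UNIV - a)) \<union> (shift n -` (UNIV - a) - (UNIV - a)) =
        (a - shift n -` a) \<union> (shift n -` a - a)" for n
      by auto
    then show ?case using Compl.IH[OF Compl.prems] by simp
  next
    case (Union A)
    have A: "A k \<in> sets binary_sequences" for k using Union.hyps(1)[of k] gen by simp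
    define U where "U = (\<Union>k. A k)"
    have U: "U \<in> sets binary_sequences" using A by (auto simp: U_def)
    have inc: "incseq (\<lambda>K. \<Union>k<K. A k)" by (force simp: incseq_def)
    have "(\<lambda>K. measure itinerary_law (\<Union>k<K. A k)) \<longlonglongrightarrow> measure itinerary_law (\<Union>K. \<Union>k<K. A k)"
      by (rule M.finite_Lim_measure_incseq[OF _ inc]) (use A in auto)
    moreover have "(\<Union>K. \<Union>k<K. A k) = U" by (auto simp: U_def)
    ultimately have "(\<lambda>K. measure itinerary_law (\<Union>k<K. A k)) \<longlonglongrightarrow> measure itinerary_law U" by simp
    \<comment> \<open>Finitely many sets exhaust the union up to \<open>\<epsilon> / 4\<close>. The
      remainder \<open>V\<close> and its translate have equal measure, so the tail costs at most
      \<open>\<epsilon> / 2\<close>, which leaves as much for the finite part.\<close>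
    then have "eventually (\<lambda>K. measure itinerary_law U - \<epsilon> / 4 < measure itinerary_law (\<Union>k<K. A k)) sequentially"
      by (rule order_tendstoD) (use Union.prems in simp)
    then obtain K where K: "measure itinerary_law U - \<epsilon> / 4 < measure itinerary_law (\<Union>k<K. A k)"
      by (auto simp: eventually_sequentially)
    define V where "V = U - (\<Union>k<K. A k)"
    have AK: "(\<Union>k<K. A k) \<in> sets binary_sequences" using A by auto
    have V: "V \<in> sets binary_sequences" using U AK by (auto simp: V_def)
    have mV: "measure itinerary_law V \<le> \<epsilon> / 4"
      unfolding V_def using U AK K by (subst M.finite_measure_Diff) (auto simp: U_def)
    have "eventually (\<lambda>m. \<forall>k\<in>{..<K}. \<forall>n\<in>S m. measure itinerary_law ((A k - shift n -` A k) \<union> (shift n -` A k - A k))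
        \<le> \<epsilon> / (2 * (real K + 1))) sequentially"
      using Union.prems by (intro eventually_ball_finite ballI Union.IH) auto
    then have "eventually (\<lambda>m. \<forall>n\<in>S m. measure itinerary_law ((U - shift n -` U) \<union> (shift n -` U - U)) \<le> \<epsilon>) sequentially"
    proof eventually_elim
      case (elim m)
      show ?case
      proof
        fix n assume n: "n \<in> S m"
        define B where "B k = (A k - shift n -` A k) \<union> (shift n -` A k - A k)" for k
        have B: "B k \<in> sets binary_sequences" for k unfolding B_def by (rule sd[OF A])
        have BK: "(\<Union>k<K. B k) \<in> sets binary_sequences" using B by auto
        have VV: "V \<union> shift n -` V \<in> sets binary_sequences" using V vm[OF V, of n] by auto
        have "(U - shift n -` U) \<union> (shift n -` U - U) \<subseteq> (\<Union>k<K. B k) \<union> (V \<union> shift n -` V)"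
          using sym_diff_UN_subset[of A "\<lambda>k. shift n -` A k" K]
          by (simp add: U_def V_def B_def vimage_UN vimage_Diff)
        then have "measure itinerary_law ((U - shift n -` U) \<union> (shift n -` U - U)) \<le> measure itinerary_law ((\<Union>k<K. B k) \<union> (V \<union> shift n -` V))"
          using BK VV by (intro M.finite_measure_mono) auto
        also have "\<dots> \<le> measure itinerary_law (\<Union>k<K. B k) + measure itinerary_law (V \<union> shift n -` V)"
          using BK VV by (intro measure_Un_le) auto
        also have "measure itinerary_law (V \<union> shift n -` V) \<le> measure itinerary_law V + measure itinerary_law (shift n -` V)"
          using V vm[OF V, of n] by (intro measure_Un_le) auto
        also have "measure itinerary_law (shift n -` V) = measure itinerary_law V" by (rule measure_shift_vimage[OF V])
        also have "measure itinerary_law (\<Union>k<K. B k) \<le> (\<Sum>k<K. measure itinerary_law (B k))"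
          using B by (intro M.finite_measure_subadditive_finite) auto
        also have "\<dots> \<le> (\<Sum>k<K. \<epsilon> / (2 * (real K + 1)))"
          using elim n by (intro sum_mono) (auto simp: B_def)
        also have "\<dots> \<le> \<epsilon> / 2" using Union.prems by (simp add: field_simps)
        finally show "measure itinerary_law ((U - shift n -` U) \<union> (shift n -` U - U)) \<le> \<epsilon>" using mV by simp
      qed
    qed
    then show ?case by (simp add: U_def)
  qed
qed

section \<open>Transfer to the reals\<close>

lemma ex_inj_binary_sequences_real: "\<exists>f :: (int \<Rightarrow> bool) \<Rightarrow> real. inj f"
proof -
  obtain g :: "nat set \<Rightarrow> real" where g: "bij g"
    using nat_sets_eqpoll_reals unfolding eqpoll_def by blast
  have "inj (\<lambda>x. g {k. x (int_decode k)})"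
  proof (rule injI)
    fix x y :: "int \<Rightarrow> bool" assume "g {k. x (int_decode k)} = g {k. y (int_decode k)}"
    then have "{k. x (int_decode k)} = {k. y (int_decode k)}" using g by (simp add: bij_def inj_def)
    then have "x (int_decode (int_encode i)) = y (int_decode (int_encode i))" for i by blast
    then show "x = y" by (simp add: fun_eq_iff)
  qed
  then show ?thesis by blast
qed

lemma set_of_rigidity_shift:
  fixes M :: "(int \<Rightarrow> bool) measure"
  assumes "prob_space M" and sets: "sets M = sets binary_sequences"
    and inv: "\<And>n. distr M M (shift n) = M"
    and erg: "\<And>D. D \<in> sets M \<Longrightarrow> shift 1 -` D = D \<Longrightarrow> measure M D = 0 \<or> measure M D = 1"
    and nontriv: "A \<in> sets M" "0 < measure M A" "measure M A < 1"
    and rig: "\<And>D \<epsilon>. D \<in> sets M \<Longrightarrow> \<epsilon> > 0 \<Longrightarrow>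
      finite {n\<in>S. measure M ((D - shift n -` D) \<union> (shift n -` D - D)) > \<epsilon>}"
    and "infinite S"
  shows "set_of_rigidity S"
proof -
  interpret M: prob_space M by fact
  have sp: "space M = UNIV" using sets_eq_imp_space_eq[OF sets] by simp
  obtain f :: "(int \<Rightarrow> bool) \<Rightarrow> real" where f: "inj f" using ex_inj_binary_sequences_real by blast
  define N where "N = embed_measure M f"
  define T where "T = (\<lambda>y. f (shift 1 (inv f y)))"
  have Tf: "T (f x) = f (shift 1 x)" for x using f by (simp add: T_def)
  have spN: "space N = range f" by (simp add: N_def space_embed_measure sp)
  have setsN: "sets N = {f ` A | A. A \<in> sets M}" using f by (simp add: N_def sets_embed_measure)
  have measN: "measure N (f ` A) = measure M A" if "A \<in> sets M" for A
    unfolding measure_def N_def using f that by (simp add: emeasure_embed_measure_image)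
  have shiftM: "shift n \<in> measurable M M" for n
    using shift_measurable[of n] measurable_cong_sets[OF sets sets] by blast
  have fN: "f \<in> measurable M N" unfolding N_def using f by (rule measurable_embed_measure2)
  have bij: "bij_betw T (range f) (range f)"
  proof (rule bij_betw_byWitness[where f' = "\<lambda>y. f (shift (-1) (inv f y))"])
    show "\<forall>a\<in>range f. f (shift (-1) (inv f (T a))) = a"
      using f by (auto simp: Tf shift_shift)
    show "\<forall>a\<in>range f. T (f (shift (-1) (inv f a))) = a"
      using f by (auto simp: Tf shift_shift)
  qed (auto simp: T_def)
  have Tinv: "inv_into (range f) T (f x) = f (shift (-1) x)" for x
    by (rule inv_into_f_eq[OF bij_betw_imp_inj_on[OF bij]]) (auto simp: Tf shift_shift)
  \<comment> \<open>Used for \<open>T\<close> with \<open>k = 1\<close> and for its inverse with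
    \<open>k = - 1\<close>.\<close>
  have mp: "g \<in> measurable N N \<and> distr N N g = N" if g: "\<And>x. g (f x) = f (shift k x)" for g k
  proof
    have "(\<lambda>x. g (f x)) \<in> measurable M N"
      unfolding g by (rule measurable_compose[OF shiftM fN])
    then show gN: "g \<in> measurable N N"
      unfolding N_def by (rule measurable_embed_measure1)
    have "distr N N g = distr (distr M N f) N g"
      unfolding N_def using embed_measure_eq_distr[OF f, of M] by simp
    also have "\<dots> = distr M N (g \<circ> f)" by (rule distr_distr[OF gN fN])
    also have "g \<circ> f = f \<circ> shift k" by (auto simp: g)
    also have "distr M N (f \<circ> shift k) = distr (distr M M (shift k)) N f"
      by (rule distr_distr[OF fN shiftM, symmetric])
    also have "\<dots> = N" unfolding inv unfolding N_def by (rule embed_measure_eq_distr[OF f, symmetric])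
    finally show "distr N N g = N" .
  qed
  have NM: "N = distr M N f" unfolding N_def by (rule embed_measure_eq_distr[OF f])
  have "prob_space N" by (subst NM) (rule M.prob_space_distr[OF fN])
  then have "inv_mps N T"
    using bij mp[OF Tf] mp[OF Tinv] by (simp add: inv_mps_def spN)
  moreover have "ergodic_sys N T"
    unfolding ergodic_sys_def spN setsN
  proof clarsimp
    fix A assume A: "A \<in> sets M" "T -` f ` A \<inter> range f = f ` A" and "measure N (f ` A) \<noteq> 1"
    have "x \<in> shift 1 -` A \<longleftrightarrow> x \<in> A" for x
    proof -
      have "x \<in> A \<longleftrightarrow> f x \<in> T -` f ` A \<inter> range f" unfolding A(2) using f by (simp add: inj_image_mem_iff)
      then show ?thesis using f by (simp add: Tf inj_image_mem_iff)
    qed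
    then have "shift 1 -` A = A" by blast
    then show "measure N (f ` A) = 0" using erg[OF A(1)] \<open>measure N (f ` A) \<noteq> 1\<close> measN[OF A(1)] by simp
  qed
  moreover have "nontrivial_sys N"
    unfolding nontrivial_sys_def setsN using nontriv measN[of A] by auto
  moreover have "rigid_along N T S"
    unfolding rigid_along_def
  proof (intro ballI allI impI)
    fix D and \<epsilon> :: real assume "D \<in> sets N" "\<epsilon> > 0"
    then obtain A where A: "A \<in> sets M" "D = f ` A" by (auto simp: setsN)
    have pow: "(T ^^ k) (f x) = f (shift (int k) x)" for k x
      by (induction k) (simp_all add: Tf shift_shift add.commute)
    have powi: "(inv_into (range f) T ^^ k) (f x) = f (shift (- int k) x)" for k x
      by (induction k) (simp_all add: Tinv shift_shift)
    have tp: "tpow N T n (f x) = f (shift n x)" for n x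
      by (simp add: tpow_def spN pow powi)
    have img: "tpow N T n ` D = f ` (shift (- n) -` A)" for n
    proof -
      have "tpow N T n ` D = f ` (shift n ` A)" by (simp add: A image_image tp)
      also have "shift n ` A = shift (- n) -` A"
      proof (intro set_eqI iffI)
        fix x assume "x \<in> shift (- n) -` A"
        then show "x \<in> shift n ` A"
          by (intro image_eqI[of _ _ "shift (- n) x"]) (auto simp: shift_shift)
      qed (auto simp: shift_shift)
      finally show ?thesis .
    qed
    have "measure N ((D - tpow N T n ` D) \<union> (tpow N T n ` D - D)) = measure M ((A - shift n -` A) \<union> (shift n -` A - A))" for n
    proof -
      have vm: "shift k -` B \<in> sets M" if "B \<in> sets M" for k B
        using measurable_sets[OF shiftM that, of k] by (simp add: sp)
      \<comment> \<open>Images under the power \<open>n\<close> are preimages under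
        \<open>shift (- n)\<close>; pulling back by the measure preserving \<open>shift n\<close>
        turns this symmetric difference into the one of the hypothesis.\<close>
      define C where "C = (A - shift (- n) -` A) \<union> (shift (- n) -` A - A)"
      have C: "C \<in> sets M" unfolding C_def using A(1) vm[OF A(1)] by auto
      have "(D - tpow N T n ` D) \<union> (tpow N T n ` D - D) = f ` C"
        unfolding img unfolding A(2) C_def using f by (simp add: image_Un image_set_diff)
      then have "measure N ((D - tpow N T n ` D) \<union> (tpow N T n ` D - D)) = measure (distr M M (shift n)) C"
        using measN[OF C] inv by simp
      also have "\<dots> = measure M (shift n -` C)" using C shiftM by (simp add: measure_distr sp)
      also have "shift n -` C = (A - shift n -` A) \<union> (shift n -` A - A)"
        by (auto simp: C_def shift_shift)
      finally show ?thesis .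
    qed
    then show "finite {n \<in> S. measure N ((D - tpow N T n ` D) \<union> (tpow N T n ` D - D)) > \<epsilon>}"
      using rig[OF A(1) \<open>\<epsilon> > 0\<close>] by simp
  qed
  ultimately show ?thesis
    unfolding set_of_rigidity_def using \<open>infinite S\<close> by blast
qed

section \<open>The Bohr topology\<close>

text \<open>A character of the integers is determined by its value at 1, whose angle, in full turns,
  is \<open>\<alpha>\<close>. Negative arguments follow from
  \<open>c n * c (- n) = 1\<close>.\<close>

lemma circle_hom_cis:
  assumes "circle_hom c"
  obtains \<alpha> :: real where "\<And>n. c n = cis (2 * pi * (of_int n * \<alpha>))"
proof -
  have norm: "norm (c n) = 1" for n using assms by (simp add: circle_hom_def)
  have add: "c (m + n) = c m * c n" for m n using assms by (simp add: circle_hom_def)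
  define \<alpha> where "\<alpha> = Arg (c 1) / (2 * pi)"
  have "c 1 \<noteq> 0" using norm[of 1] by auto
  then have c1: "c 1 = cis (2 * pi * \<alpha>)" using norm[of 1] by (simp add: \<alpha>_def cis_Arg sgn_div_norm)
  have "c 0 \<noteq> 0" using norm[of 0] by auto
  then have c0: "c 0 = 1" using add[of 0 0] by simp
  have nat: "c (int k) = cis (2 * pi * (of_int (int k) * \<alpha>))" for k
  proof (induction k)
    case (Suc k)
    have "c (int (Suc k)) = c (int k) * c 1" using add[of "int k" 1] by (simp add: add.commute)
    then show ?case using Suc by (simp add: c1 cis_mult algebra_simps)
  qed (simp add: c0)
  have "c n = cis (2 * pi * (of_int n * \<alpha>))" for n
  proof (cases "0 \<le> n")
    case True
    then show ?thesis using nat[of "nat n"] by simp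
  next
    case False
    then have "c (- n) = cis (2 * pi * (of_int (- n) * \<alpha>))" using nat[of "nat (- n)"] by simp
    moreover have "c n * c (- n) = 1" using add[of n "- n"] c0 by simp
    moreover have "cis (2 * pi * (of_int n * \<alpha>)) * cis (2 * pi * (of_int (- n) * \<alpha>)) = 1"
      by (simp add: cis_mult)
    ultimately show ?thesis by (metis cis_neq_zero mult_right_cancel)
  qed
  then show thesis by (rule that)
qed

text \<open>Induction over the generation of the topology, for all points of the set at once: a
  subbasic set needs one character, intersections unite the finite families and take the smaller
  radius, unions keep the data of one member.\<close>

lemma bohr_open_nbhd:
  assumes "openin bohr_topology V" "n0 \<in> V"
  obtains F \<delta> where "finite F" "\<And>c. c \<in> F \<Longrightarrow> circle_hom c" "0 < \<delta>"
    "\<And>n. (\<And>c. c \<in> F \<Longrightarrow> dist (c n) (c n0) < \<delta>) \<Longrightarrow> n \<in> V"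
proof -
  define nb where "nb W n0 F \<delta> \<longleftrightarrow> finite F \<and> (\<forall>c\<in>F. circle_hom c) \<and> 0 < \<delta> \<and>
    (\<forall>n. (\<forall>c\<in>F. dist (c n) (c n0) < \<delta>) \<longrightarrow> n \<in> W)" for W :: "int set" and n0 F and \<delta> :: real
  have "generate_topology_on {c -` U | c U. circle_hom c \<and> open (U :: complex set)} V"
    using assms by (simp add: bohr_topology_def openin_topology_generated_by_iff)
  then have "\<forall>n0\<in>V. \<exists>F \<delta>. nb V n0 F \<delta>"
  proof (induction rule: generate_topology_on.induct)
    case (Int a b)
    show ?case
    proof
      fix n0 assume "n0 \<in> a \<inter> b"
      then obtain F G \<delta> \<eta> where "nb a n0 F \<delta>" "nb b n0 G \<eta>" using Int.IH by blast
      then have "nb (a \<inter> b) n0 (F \<union> G) (min \<delta> \<eta>)" by (auto simp: nb_def)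
      then show "\<exists>F \<delta>. nb (a \<inter> b) n0 F \<delta>" by blast
    qed
  next
    case (UN K)
    show ?case
    proof
      fix n0 assume "n0 \<in> \<Union>K"
      then obtain k F \<delta> where k: "k \<in> K" "nb k n0 F \<delta>" using UN.IH by blast
      then have "nb (\<Union>K) n0 F \<delta>" unfolding nb_def by blast
      then show "\<exists>F \<delta>. nb (\<Union>K) n0 F \<delta>" by blast
    qed
  next
    case (Basis s)
    then obtain c U where c: "s = c -` U" "circle_hom c" "open (U :: complex set)" by blast
    show ?case
    proof
      fix n0 assume "n0 \<in> s"
      then obtain e where "e > 0" "ball (c n0) e \<subseteq> U" using c open_contains_ball by blast
      then have "nb s n0 {c} e" using c by (auto simp: nb_def dist_commute)
      then show "\<exists>F \<delta>. nb s n0 F \<delta>" by blast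
    qed
  qed simp
  then obtain F \<delta> where "nb V n0 F \<delta>" using assms(2) by blast
  then show thesis unfolding nb_def using that[of F \<delta>] by blast
qed

text \<open>A single parameter \<open>k\<close> stands for the number of frequencies, the tolerance
  \<open>1 / k\<close> and the range of targets. It may be enlarged at will, so every basic
  neighbourhood is reached.\<close>

lemma bohr_denseI:
  fixes S :: "int set"
  assumes "\<And>k n0 (\<alpha>::nat\<Rightarrow>real). 0 < k \<Longrightarrow> \<bar>n0\<bar> \<le> int k \<Longrightarrow>
      \<exists>n\<in>S. \<forall>i<k. \<exists>m::int. \<bar>of_int (n - n0) * \<alpha> i - of_int m\<bar> < 1 / real k"
  shows "bohr_dense S"
proof -
  have one: "circle_hom (\<lambda>_. 1)" by (simp add: circle_hom_def)
  have top: "topspace bohr_topology = UNIV"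
  proof -
    have "UNIV = (\<lambda>_::int. 1::complex) -` UNIV" by simp
    then have "UNIV \<in> {c -` U | c U. circle_hom c \<and> open (U :: complex set)}"
      using one open_UNIV by blast
    then show ?thesis unfolding bohr_topology_def by (auto simp: topology_generated_by_topspace)
  qed
  have "n0 \<in> bohr_topology closure_of S" for n0
    unfolding in_closure_of
  proof (intro conjI allI impI)
    fix V assume "n0 \<in> V \<and> openin bohr_topology V"
    then obtain F \<delta> where F: "finite F" "\<And>c. c \<in> F \<Longrightarrow> circle_hom c" "0 < \<delta>"
      "\<And>n. (\<And>c. c \<in> F \<Longrightarrow> dist (c n) (c n0) < \<delta>) \<Longrightarrow> n \<in> V"
      using bohr_open_nbhd by metis
    have "isCont (\<lambda>t. exp (\<i> * complex_of_real t)) 0" by (intro continuous_intros)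
    then have "isCont (\<lambda>t. cis t) 0" by (simp only: cis_conv_exp)
    then obtain \<eta> where \<eta>: "\<eta> > 0" "\<And>t. \<bar>t\<bar> < \<eta> \<Longrightarrow> dist (cis t) 1 < \<delta>"
      unfolding continuous_at_eps_delta using F(3) by (auto simp: dist_real_def)
    have "\<exists>\<alpha>. \<forall>n. c n = cis (2 * pi * (of_int n * \<alpha>))" if "c \<in> F" for c
      using circle_hom_cis[OF F(2)[OF that]] by metis
    then obtain \<beta> where \<beta>: "\<And>c n. c \<in> F \<Longrightarrow> c n = cis (2 * pi * (of_int n * \<beta> c))" by metis
    obtain g where g: "bij_betw g {..<card F} F"
      using ex_bij_betw_nat_finite[OF F(1)] by (auto simp: lessThan_atLeast0)
    obtain k0 :: nat where k0: "2 * pi / \<eta> < real k0" using reals_Archimedean2 by blast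
    \<comment> \<open>Exceeds the number of characters and \<open>\<bar>n0\<bar>\<close>, and makes
      \<open>2 * pi / k\<close> less than \<open>\<eta>\<close>.\<close>
    define k where "k = Suc (max k0 (max (card F) (nat \<bar>n0\<bar>)))"
    have "2 * pi / \<eta> < real k" using k0 by (simp add: k_def)
    then have k\<eta>: "2 * pi / real k < \<eta>" using \<eta>(1) by (simp add: field_simps k_def)
    have "0 < k" "\<bar>n0\<bar> \<le> int k" by (auto simp: k_def)
    \<comment> \<open>From index \<open>card F\<close> on the frequencies are arbitrary padding up
      to length \<open>k\<close>.\<close>
    then obtain n where n: "n \<in> S" "\<And>i. i < k \<Longrightarrow> \<exists>m::int. \<bar>of_int (n - n0) * \<beta> (g i) - of_int m\<bar> < 1 / real k"
      using assms[of k n0 "\<lambda>i. \<beta> (g i)"] by blast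
    have "n \<in> V"
    proof (rule F(4))
      fix c assume c: "c \<in> F"
      then have "c \<in> g ` {..<card F}" using g by (simp add: bij_betw_def)
      then obtain i where i: "i < card F" "c = g i" by blast
      then have "i < k" by (simp add: k_def)
      then obtain m :: int where m: "\<bar>of_int (n - n0) * \<beta> c - of_int m\<bar> < 1 / real k" using n(2) i by blast
      define t where "t = of_int (n - n0) * \<beta> c - of_int m"
      have "\<bar>2 * pi * t\<bar> = 2 * pi * \<bar>t\<bar>" by (simp add: abs_mult)
      also have "\<dots> \<le> 2 * pi * (1 / real k)" using m by (intro mult_left_mono) (auto simp: t_def)
      finally have "\<bar>2 * pi * t\<bar> < \<eta>" using k\<eta> by simp
      then have d: "dist (cis (2 * pi * t)) 1 < \<delta>" by (rule \<eta>(2))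
      \<comment> \<open>The integer \<open>m\<close> amounts to whole turns, so \<open>c n\<close>
        is \<open>c n0\<close> rotated by the small angle \<open>2 * pi * t\<close>.\<close>
      have "2 * pi * (of_int n * \<beta> c) = 2 * pi * (of_int n0 * \<beta> c) + (2 * pi * t + 2 * pi * of_int m)"
        by (simp add: t_def algebra_simps)
      then have "c n = c n0 * (cis (2 * pi * t) * cis (2 * pi * of_int m))"
        by (simp only: \<beta>[OF c] cis_mult[symmetric])
      then have "c n = c n0 * cis (2 * pi * t)" by (simp add: cis_multiple_2pi)
      then have "dist (c n) (c n0) = norm (c n0) * dist (cis (2 * pi * t)) 1"
        by (simp add: dist_norm right_diff_distrib flip: norm_mult)
      also have "norm (c n0) = 1" by (simp add: \<beta>[OF c])
      finally show "dist (c n) (c n0) < \<delta>" using d by simp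
    qed
    then show "\<exists>y. y \<in> S \<and> y \<in> V" using n(1) by blast
  qed (simp add: top)
  then show ?thesis unfolding bohr_dense_def by blast
qed

text \<open>If \<open>S\<close> were finite, let \<open>n0\<close> lie outside it and
  \<open>B\<close> bound the distances to \<open>n0\<close>. For the frequency
  \<open>1 / (2 * B)\<close>, being within \<open>1 / (3 * B)\<close> of an integer forces
  \<open>n - n0\<close> to be a multiple of \<open>2 * B\<close>; as it is at most \<open>B\<close>
  in size, \<open>n = n0\<close>, a contradiction.\<close>

lemma infinite_if_approximates:
  fixes S :: "int set"
  assumes "\<And>k n0 (\<alpha>::nat\<Rightarrow>real). 0 < k \<Longrightarrow> \<bar>n0\<bar> \<le> int k \<Longrightarrow>
      \<exists>n\<in>S. \<forall>i<k. \<exists>m::int. \<bar>of_int (n - n0) * \<alpha> i - of_int m\<bar> < 1 / real k"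
  shows "infinite S"
proof
  assume fin: "finite S"
  obtain n0 :: int where n0: "n0 \<notin> S" using fin ex_new_if_finite infinite_UNIV_int by blast
  define B where "B = Max (insert 1 ((\<lambda>n. \<bar>n - n0\<bar>) ` S))"
  have B: "1 \<le> B" "\<And>n. n \<in> S \<Longrightarrow> \<bar>n - n0\<bar> \<le> B" using fin by (auto simp: B_def)
  define k where "k = nat (3 * B + \<bar>n0\<bar>)"
  have k: "0 < k" "\<bar>n0\<bar> \<le> int k" "3 * B \<le> int k" using B(1) by (auto simp: k_def)
  obtain n m where n: "n \<in> S" and m: "\<bar>of_int (n - n0) * (1 / (2 * of_int B)) - real_of_int m\<bar> < 1 / real k"
    using assms[of k n0 "\<lambda>_. 1 / (2 * of_int B)"] k by blast
  have "1 / real k \<le> 1 / (3 * of_int B)" using k(3) B(1) by (intro divide_left_mono) auto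
  then have "\<bar>of_int (n - n0) * (1 / (2 * of_int B)) - real_of_int m\<bar> * (2 * of_int B) < 1 / (3 * of_int B) * (2 * of_int B)"
    using m B(1) by (intro mult_strict_right_mono) auto
  also have "\<dots> < 1" using B(1) by simp
  finally have "\<bar>of_int (n - n0) * (1 / (2 * of_int B)) - real_of_int m\<bar> * \<bar>2 * real_of_int B\<bar> < 1" using B(1) by simp
  then have "\<bar>(of_int (n - n0) * (1 / (2 * of_int B)) - real_of_int m) * (2 * of_int B)\<bar> < 1" by (simp only: abs_mult)
  moreover have "(of_int (n - n0) * (1 / (2 * of_int B)) - real_of_int m) * (2 * of_int B) = real_of_int (n - n0 - m * (2 * B))"
    using B(1) by (simp add: field_simps)
  ultimately have "\<bar>real_of_int (n - n0 - m * (2 * B))\<bar> < 1" by (simp only:)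
  then have "\<bar>n - n0 - m * (2 * B)\<bar> < 1" by (simp only: of_int_abs[symmetric] of_int_less_1_iff)
  then have eq: "n - n0 = m * (2 * B)" by simp
  then have "\<bar>m\<bar> * (2 * B) \<le> B" using B(1) B(2)[OF n] by (simp add: abs_mult)
  then have "m = 0" using B(1) by (smt (verit) mult_le_cancel_right1)
  then show False using eq n n0 by simp
qed

theorem theorem5p4:
  shows "\<exists>S :: int set. set_of_rigidity S \<and> bohr_dense S"
proof -
  \<comment> \<open>The conclusion of \<open>periodic_approximation_stage\<close> at level
    \<open>m\<close>, with \<open>\<epsilon> = (1/2) ^ Suc m\<close> for summable errors and
    \<open>k = Suc m\<close>, so that every positive \<open>k\<close> occurs.\<close>
  define good :: "int \<Rightarrow> nat \<Rightarrow> int set \<Rightarrow> int \<Rightarrow> (int \<Rightarrow> int) \<Rightarrow> bool" where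
    "good l m S R \<phi> \<longleftrightarrow> finite S \<and> 2 \<le> R \<and> (\<forall>p. 0 \<le> \<phi> p \<and> \<phi> p < l) \<and>
      (\<forall>i. 0 \<le> i \<longrightarrow> i < l \<longrightarrow> int (card {p\<in>{0..<l * R}. \<phi> p = i}) = R) \<and>
      (\<forall>n. \<bar>n\<bar> \<le> 2 * l \<longrightarrow>
        real (card {p\<in>{0..<l * R}. \<phi> ((p + n) mod (l * R)) \<noteq> (\<phi> p + n) mod l}) \<le> (1/2) ^ Suc m * of_int (l * R)) \<and>
      (\<forall>n\<in>S. \<bar>n\<bar> \<le> l * R) \<and>
      (\<forall>n\<in>S. real (card {p\<in>{0..<l * R}. \<phi> ((p + n) mod (l * R)) \<noteq> \<phi> p}) \<le> (1/2) ^ Suc m * of_int (l * R)) \<and>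
      (\<forall>n0 (\<alpha>::nat\<Rightarrow>real). \<bar>n0\<bar> \<le> int (Suc m) \<longrightarrow>
        (\<exists>n\<in>S. \<forall>i<Suc m. \<exists>m'::int. \<bar>of_int (n - n0) * \<alpha> i - of_int m'\<bar> < 1 / real (Suc m)))" for l m S R \<phi>
  have "\<exists>S R \<phi>. good l m S R \<phi>" if l: "2 \<le> l" for l m
  proof -
    have pos: "(0::real) < (1/2) ^ Suc m" by simp
    show ?thesis
    proof (rule periodic_approximation_stage[OF l zero_less_Suc[of m] pos])
      fix S R \<phi>
      assume *: "finite S" "2 \<le> R" "\<And>p. 0 \<le> \<phi> p \<and> \<phi> p < l"
        "\<And>i. 0 \<le> i \<Longrightarrow> i < l \<Longrightarrow> int (card {p\<in>{0..<l * R}. \<phi> p = i}) = R"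
        "\<And>n. \<bar>n\<bar> \<le> 2 * l \<Longrightarrow>
          real (card {p\<in>{0..<l * R}. \<phi> ((p + n) mod (l * R)) \<noteq> (\<phi> p + n) mod l}) \<le> (1/2) ^ Suc m * of_int (l * R)"
        "\<And>n. n \<in> S \<Longrightarrow> \<bar>n\<bar> \<le> l * R"
        "\<And>n. n \<in> S \<Longrightarrow>
          real (card {p\<in>{0..<l * R}. \<phi> ((p + n) mod (l * R)) \<noteq> \<phi> p}) \<le> (1/2) ^ Suc m * of_int (l * R)"
        "\<And>n0 (\<alpha>::nat\<Rightarrow>real). \<bar>n0\<bar> \<le> int (Suc m) \<Longrightarrow>
          \<exists>n\<in>S. \<forall>i<Suc m. \<exists>m'::int. \<bar>of_int (n - n0) * \<alpha> i - of_int m'\<bar> < 1 / real (Suc m)"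
      have "good l m S R \<phi>"
        unfolding good_def by (intro conjI allI ballI impI *) (use *(3) in blast)+
      then show "\<exists>S R \<phi>. good l m S R \<phi>" by blast
    qed
  qed
  then obtain Sf Rf \<phi>f where f: "\<And>l m. 2 \<le> l \<Longrightarrow> good l m (Sf l m) (Rf l m) (\<phi>f l m)" by metis
  \<comment> \<open>Only the periods need recursion; all other data of level \<open>m\<close> are
    functions of \<open>L m\<close> and \<open>m\<close>.\<close>
  define L where "L = rec_nat 2 (\<lambda>m l. l * Rf l m)"
  define R where "R m = Rf (L m) m" for m
  define \<phi> where "\<phi> m = \<phi>f (L m) m" for m
  define S where "S m = Sf (L m) m" for m
  have LS: "L (Suc m) = L m * R m" and L0: "L 0 = 2" for m by (simp_all add: L_def R_def)
  have L2: "2 \<le> L m" for m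
  proof (induction m)
    case (Suc m)
    have "2 \<le> R m" using f[OF Suc, of m] by (simp add: R_def good_def)
    then have "2 * 1 \<le> L m * R m" using Suc by (intro mult_mono) auto
    then show ?case by (simp add: LS)
  qed (simp add: L0)
  have good: "good (L m) m (S m) (R m) (\<phi> m)" for m
    unfolding S_def R_def \<phi>_def by (rule f[OF L2])
  interpret cyclic_tower L R \<phi>
    by unfold_locales (use good in \<open>auto simp: good_def LS L0\<close>)
  obtain P p where "coded_tower L R \<phi> P p" using ex_coded_tower by blast
  then interpret coded_tower L R \<phi> P p .
  define A where "A = (\<Union>m. S m)"
  have approx: "\<exists>n\<in>A. \<forall>i<k. \<exists>m::int. \<bar>of_int (n - n0) * \<alpha> i - of_int m\<bar> < 1 / real k"
    if "0 < k" "\<bar>n0\<bar> \<le> int k" for k n0 and \<alpha> :: "nat \<Rightarrow> real"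
  proof -
    obtain m where m: "k = Suc m" using \<open>0 < k\<close> gr0_conv_Suc by blast
    from good[of m] have "\<forall>n0 (\<alpha>::nat\<Rightarrow>real). \<bar>n0\<bar> \<le> int (Suc m) \<longrightarrow>
        (\<exists>n\<in>S m. \<forall>i<Suc m. \<exists>m'::int. \<bar>of_int (n - n0) * \<alpha> i - of_int m'\<bar> < 1 / real (Suc m))"
      unfolding good_def by (elim conjE)
    then have "\<exists>n\<in>S m. \<forall>i<Suc m. \<exists>m'::int. \<bar>of_int (n - n0) * \<alpha> i - of_int m'\<bar> < 1 / real (Suc m)"
      using \<open>\<bar>n0\<bar> \<le> int k\<close> by (simp only: m)
    then show ?thesis unfolding A_def m by (rule bexE) (rule bexI, assumption, rule UN_I[OF UNIV_I], assumption)
  qed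
  have "set_of_rigidity A"
  proof (rule set_of_rigidity_shift[OF prob_space_itinerary_law sets_itinerary_law itinerary_law_shift])
    show "measure itinerary_law D = 0 \<or> measure itinerary_law D = 1" if "D \<in> sets itinerary_law" "shift 1 -` D = D" for D
      using itinerary_law_ergodic that by simp
    have "Measurable.pred binary_sequences (\<lambda>x. x 0)" by measurable
    then show "{x. x 0} \<in> sets itinerary_law" by (simp add: pred_def)
    show "0 < measure itinerary_law {x. x 0}" "measure itinerary_law {x. x 0} < 1" by (simp_all add: itinerary_law_nontrivial)
    show "infinite A" by (rule infinite_if_approximates[OF approx])
    fix D and \<epsilon> :: real assume D: "D \<in> sets itinerary_law" "\<epsilon> > 0"
    have "eventually (\<lambda>m. \<forall>n\<in>S m. measure itinerary_law ((D - shift n -` D) \<union> (shift n -` D - D)) \<le> \<epsilon>) sequentially"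
      by (rule itinerary_law_rigid) (use good D in \<open>auto simp: good_def LS\<close>)
    then obtain m0 where m0: "\<And>m n. m0 \<le> m \<Longrightarrow> n \<in> S m \<Longrightarrow> measure itinerary_law ((D - shift n -` D) \<union> (shift n -` D - D)) \<le> \<epsilon>"
      by (auto simp: eventually_sequentially)
    \<comment> \<open>A time violating the bound belongs only to levels below \<open>m0\<close>, and
      each level contributes finitely many times.\<close>
    have "{n\<in>A. measure itinerary_law ((D - shift n -` D) \<union> (shift n -` D - D)) > \<epsilon>} \<subseteq> (\<Union>m<m0. S m)"
    proof
      fix n assume n: "n \<in> {n\<in>A. measure itinerary_law ((D - shift n -` D) \<union> (shift n -` D - D)) > \<epsilon>}"
      then obtain m where m: "n \<in> S m" by (auto simp: A_def)
      then have "\<not> m0 \<le> m" using m0[of m n] n by auto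
      then show "n \<in> (\<Union>m<m0. S m)" using m by auto
    qed
    moreover have "finite (\<Union>m<m0. S m)" using good by (auto simp: good_def)
    ultimately show "finite {n\<in>A. measure itinerary_law ((D - shift n -` D) \<union> (shift n -` D - D)) > \<epsilon>}"
      by (rule finite_subset)
  qed
  moreover have "bohr_dense A" by (rule bohr_denseI[OF approx])
  ultimately show ?thesis by blast
qed

end
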